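(* Let $\mathcal V$ be a congruence distributive variety. (1) If $m\geq2$ and $\mathcal V$ is $m$-modular, then $$J_{\mathcal V}(2)\leq J^{\smile}_{\mathcal V}(1)+2m^2-2m-2\quad\text{and}\quad J^{\smile}_{\mathcal V}(2)\leq J_{\mathcal V}(1)+2m^2-2m-2.$$ (2) If $\mathcal V$ has $k+2$ Gumm terms, then $$J_{\mathcal V}(2)\leq J^{\smile}_{\mathcal V}(1)+2k\quad\text{and}\quad J^{\smile}_{\mathcal V}(2)\leq J_{\mathcal V}(1)+2k.$$ The bounds can be improved by $1$ if $J^{\smile}_{\mathcal V}(1)$ is odd, respectively, if $J_{\mathcal V}(1)$ is even; that is, if $J^{\smile}_{\mathcal V}(1)$ is odd, then $J_{\mathcal V}(2)\leq J^{\smile}_{\mathcal V}(1)+2k-1$, and if $J_{\mathcal V}(1)$ is even, then $J^{\smile}_{\mathcal V}(2)\leq J_{\mathcal V}(1)+2k-1$.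
   Context: $a\,(R\circ S)\,c$ means that there is $b$ with $a\,R\,b$ and $b\,S\,c$. Juxtaposition of relations denotes intersection and binds more strongly than $\circ$. $\beta\circ_n\gamma$ denotes $\beta\circ\gamma\circ\beta\circ\cdots$ with exactly $n$ alternating factors, starting with $\beta$. A congruence inclusion holds in a variety if it holds for all congruences $\alpha,\beta,\gamma$ of every algebra in the variety. For a congruence distributive variety $\mathcal V$ and $m\geq1$: $J_{\mathcal V}(m)$ is the least natural number $k$ such that $\alpha(\beta\circ_{m+1}\gamma)\subseteq\alpha\beta\circ_{k+1}\alpha\gamma$ holds in $\mathcal V$; $J^{\smile}_{\mathcal V}(m)$ is the least natural number $k$ such that $\alpha(\beta\circ_{m+1}\gamma)\subseteq\alpha\gamma\circ_{k+1}\alpha\beta$ holds in $\mathcal V$. $\mathcal V$ is $m$-modular if the congruence inclusion $\alpha(\beta\circ\alpha\gamma\circ\beta)\subseteq\alpha\beta\circ_m\alpha\gamma$ holds in $\mathcal V$. $\mathcal V$ has $k+2$ Gumm terms if there are ternary terms $p,j_1,\dots,j_{k+1}$ such that the following identities hold in $\mathcal V$: $x=p(x,z,z)$; $p(x,x,z)=j_1(x,x,z)$; $x=j_i(x,y,x)$ for $1\leq i\leq k+1$; $j_i(x,x,z)=j_{i+1}(x,x,z)$ for even $i$ with $1\leq i<k+1$; $j_i(x,z,z)=j_{i+1}(x,z,z)$ for odd $i$ with $1\leq i<k+1$; $j_{k+1}(x,y,z)=z$.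
   Formalization: The improvement by 1 in (2) is stated only for k≥1, as it is false for k=0 (Boolean algebras: J(2)=1>0); algebras of V range over subsets of one infinite set at least as large as the signature, which suffices as failures of inclusions occur in finitely generated algebras. *)

theory Defs
  imports Main "HOL-Library.Equipollence"
begin

section \<open>Algebras, terms and varieties\<close>

text \<open>A signature is a set \<open>F\<close> of pairs (operation symbol, arity). An operation of an algebra
  takes the list of its arguments; only its values on lists over the universe, of a length
  prescribed by the signature, matter.\<close>

record ('f, 'u) algebra =
  univ :: "'u set"
  interp :: "'f \<Rightarrow> 'u list \<Rightarrow> 'u"

definition algebra :: "('f \<times> nat) set \<Rightarrow> ('f, 'u) algebra \<Rightarrow> bool" where
  "algebra F A \<longleftrightarrow> univ A \<noteq> {} \<and>
     (\<forall>(f, n)\<in>F. \<forall>xs. length xs = n \<and> set xs \<subseteq> univ A \<longrightarrow> interp A f xs \<in> univ A)"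

datatype 'f trm = Var nat | App 'f "'f trm list"

primrec trm_val :: "('f, 'u) algebra \<Rightarrow> (nat \<Rightarrow> 'u) \<Rightarrow> 'f trm \<Rightarrow> 'u" where
  "trm_val A v (Var i) = v i"
| "trm_val A v (App f ts) = interp A f (map (trm_val A v) ts)"

primrec vars :: "'f trm \<Rightarrow> nat set" where
  "vars (Var i) = {i}"
| "vars (App f ts) = \<Union> (set (map vars ts))"

primrec wf_trm :: "('f \<times> nat) set \<Rightarrow> 'f trm \<Rightarrow> bool" where
  "wf_trm F (Var i) \<longleftrightarrow> True"
| "wf_trm F (App f ts) \<longleftrightarrow> (f, length ts) \<in> F \<and> (\<forall>b\<in>set (map (wf_trm F) ts). b)"

definition satisfies :: "('f, 'u) algebra \<Rightarrow> 'f trm \<times> 'f trm \<Rightarrow> bool" where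
  "satisfies A e \<longleftrightarrow>
     (\<forall>v. range v \<subseteq> univ A \<longrightarrow> trm_val A v (fst e) = trm_val A v (snd e))"

text \<open>A variety is an equational class. It is represented by its algebras whose universe is a
  subset of the type \<open>'u\<close>. If \<open>'u\<close> is infinite and has at least as many elements as there
  are operation symbols, every countably generated algebra of the variety has an isomorphic copy
  in \<open>'u\<close>. A failure of a congruence inclusion of the kind considered below involves finitely
  many elements and so persists in a finitely generated subalgebra; hence for such \<open>'u\<close> these
  inclusions hold in the algebras over \<open>'u\<close> iff they hold in all algebras of the variety.\<close>

definition variety :: "('f \<times> nat) set \<Rightarrow> ('f, 'u) algebra set \<Rightarrow> bool" where
  "variety F V \<longleftrightarrow>
     (\<exists>E. (\<forall>(s, t)\<in>E. wf_trm F s \<and> wf_trm F t) \<and>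
          V = {A. algebra F A \<and> (\<forall>e\<in>E. satisfies A e)})"

section \<open>Congruences\<close>

definition Con :: "('f \<times> nat) set \<Rightarrow> ('f, 'u) algebra \<Rightarrow> 'u rel set" where
  "Con F A = {\<theta>. equiv (univ A) \<theta> \<and>
     (\<forall>(f, n)\<in>F. \<forall>xs ys. length xs = n \<and> list_all2 (\<lambda>x y. (x, y) \<in> \<theta>) xs ys
        \<longrightarrow> (interp A f xs, interp A f ys) \<in> \<theta>)}"

definition con_join :: "('f \<times> nat) set \<Rightarrow> ('f, 'u) algebra \<Rightarrow> 'u rel \<Rightarrow> 'u rel \<Rightarrow> 'u rel" where
  "con_join F A \<beta> \<gamma> = \<Inter> {\<theta> \<in> Con F A. \<beta> \<union> \<gamma> \<subseteq> \<theta>}"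

definition congruence_distributive :: "('f \<times> nat) set \<Rightarrow> ('f, 'u) algebra set \<Rightarrow> bool" where
  "congruence_distributive F V \<longleftrightarrow>
     (\<forall>A\<in>V. \<forall>\<alpha>\<in>Con F A. \<forall>\<beta>\<in>Con F A. \<forall>\<gamma>\<in>Con F A.
        \<alpha> \<inter> con_join F A \<beta> \<gamma> = con_join F A (\<alpha> \<inter> \<beta>) (\<alpha> \<inter> \<gamma>))"

text \<open>\<open>alt_comp n \<beta> \<gamma>\<close> is \<open>\<beta> O \<gamma> O \<beta> O \<dots>\<close> with \<open>n\<close> alternating factors. The value \<open>Id\<close> for
  \<open>n = 0\<close> only starts the recursion.\<close>

primrec alt_comp :: "nat \<Rightarrow> 'u rel \<Rightarrow> 'u rel \<Rightarrow> 'u rel" where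
  "alt_comp 0 = (\<lambda>\<beta> \<gamma>. Id)"
| "alt_comp (Suc n) = (\<lambda>\<beta> \<gamma>. \<beta> O alt_comp n \<gamma> \<beta>)"

definition inclusion_holds ::
  "('f \<times> nat) set \<Rightarrow> ('f, 'u) algebra set \<Rightarrow>
   ('u rel \<Rightarrow> 'u rel \<Rightarrow> 'u rel \<Rightarrow> 'u rel) \<Rightarrow> ('u rel \<Rightarrow> 'u rel \<Rightarrow> 'u rel \<Rightarrow> 'u rel) \<Rightarrow> bool" where
  "inclusion_holds F V L R \<longleftrightarrow>
     (\<forall>A\<in>V. \<forall>\<alpha>\<in>Con F A. \<forall>\<beta>\<in>Con F A. \<forall>\<gamma>\<in>Con F A. L \<alpha> \<beta> \<gamma> \<subseteq> R \<alpha> \<beta> \<gamma>)"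

definition J :: "('f \<times> nat) set \<Rightarrow> ('f, 'u) algebra set \<Rightarrow> nat \<Rightarrow> nat" where
  "J F V m = (LEAST k. inclusion_holds F V
     (\<lambda>\<alpha> \<beta> \<gamma>. \<alpha> \<inter> alt_comp (m + 1) \<beta> \<gamma>)
     (\<lambda>\<alpha> \<beta> \<gamma>. alt_comp (k + 1) (\<alpha> \<inter> \<beta>) (\<alpha> \<inter> \<gamma>)))"

definition J_smile :: "('f \<times> nat) set \<Rightarrow> ('f, 'u) algebra set \<Rightarrow> nat \<Rightarrow> nat" where
  "J_smile F V m = (LEAST k. inclusion_holds F V
     (\<lambda>\<alpha> \<beta> \<gamma>. \<alpha> \<inter> alt_comp (m + 1) \<beta> \<gamma>)
     (\<lambda>\<alpha> \<beta> \<gamma>. alt_comp (k + 1) (\<alpha> \<inter> \<gamma>) (\<alpha> \<inter> \<beta>)))"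

definition modular :: "('f \<times> nat) set \<Rightarrow> ('f, 'u) algebra set \<Rightarrow> nat \<Rightarrow> bool" where
  "modular F V m \<longleftrightarrow> inclusion_holds F V
     (\<lambda>\<alpha> \<beta> \<gamma>. \<alpha> \<inter> (\<beta> O (\<alpha> \<inter> \<gamma>) O \<beta>))
     (\<lambda>\<alpha> \<beta> \<gamma>. alt_comp m (\<alpha> \<inter> \<beta>) (\<alpha> \<inter> \<gamma>))"

section \<open>Gumm terms\<close>

definition ternary_trm :: "('f \<times> nat) set \<Rightarrow> 'f trm \<Rightarrow> bool" where
  "ternary_trm F t \<longleftrightarrow> wf_trm F t \<and> vars t \<subseteq> {0, 1, 2}"

definition ternary_op :: "('f, 'u) algebra \<Rightarrow> 'f trm \<Rightarrow> 'u \<Rightarrow> 'u \<Rightarrow> 'u \<Rightarrow> 'u" where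
  "ternary_op A t x y z = trm_val A (\<lambda>i. if i = 0 then x else if i = 1 then y else z) t"

text \<open>\<open>has_gumm_terms F V k\<close> says that \<open>V\<close> has \<open>k + 2\<close> Gumm terms \<open>p, j\<^sub>1, \<dots>, j\<^bsub>k+1\<^esub>\<close>.\<close>

definition has_gumm_terms :: "('f \<times> nat) set \<Rightarrow> ('f, 'u) algebra set \<Rightarrow> nat \<Rightarrow> bool" where
  "has_gumm_terms F V k \<longleftrightarrow>
     (\<exists>p j. ternary_trm F p \<and> (\<forall>i\<in>{1..k+1}. ternary_trm F (j i)) \<and>
       (\<forall>A\<in>V. \<forall>x\<in>univ A. \<forall>y\<in>univ A. \<forall>z\<in>univ A.
          x = ternary_op A p x z z \<and>
          ternary_op A p x x z = ternary_op A (j 1) x x z \<and>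
          (\<forall>i\<in>{1..k+1}. x = ternary_op A (j i) x y x) \<and>
          (\<forall>i\<in>{1..<k+1}. even i \<longrightarrow> ternary_op A (j i) x x z = ternary_op A (j (i + 1)) x x z) \<and>
          (\<forall>i\<in>{1..<k+1}. odd i \<longrightarrow> ternary_op A (j i) x z z = ternary_op A (j (i + 1)) x z z) \<and>
          ternary_op A (j (k + 1)) x y z = z))"

end

theory Submission
  imports Defs
begin

text \<open>Let \<open>a \<beta> b \<gamma> c \<beta> d\<close> and \<open>a \<alpha> d\<close>. Gumm terms \<open>p, j\<^sub>1, \<dots>, j\<^bsub>k+1\<^esub>\<close> combine a term \<open>p\<close> for
  permutability with terms \<open>j\<^sub>i\<close> for distributivity, and they split the pair \<open>(a, d)\<close> accordingly
  (\<open>Gumm_split\<close>): with \<open>e = j\<^sub>1(a, b, d)\<close> the terms \<open>j\<^sub>i\<close> lead from \<open>e\<close> to \<open>d\<close> in \<open>2k\<close> alternating steps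
  modulo \<open>\<alpha> \<inter> \<gamma>\<close> and \<open>\<alpha> \<inter> \<beta>\<close>, while \<open>p\<close> yields \<open>(a, e) \<in> \<alpha> \<inter> (\<gamma> O \<beta>)\<close>. To the latter pair the inclusion
  defining \<open>J F V 1\<close> or \<open>J_smile F V 1\<close> applies, with \<open>\<beta>\<close> and \<open>\<gamma>\<close> exchanged, so that the two numbers
  swap their roles. Concatenating the two chains bounds \<open>J F V 2\<close> and \<open>J_smile F V 2\<close>; if the first
  chain ends with the relation that starts the second, one step is saved, and this is decided by
  the parity of \<open>J F V 1\<close> or \<open>J_smile F V 1\<close>.

  The numbers \<open>J F V 1\<close> and \<open>J_smile F V 1\<close> are least elements, so the argument needs that
  congruence distributivity makes some such inclusion hold at all. This is Jonsson's theorem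
  (\<open>congruence_distributive_imp_Jonsson\<close>), obtained from a finitely generated free algebra of the
  variety, which has a copy in the type \<open>'u\<close>.

  An \<open>m\<close>-modular variety has \<open>k + 2\<close> Gumm terms for \<open>k = m\<^sup>2 - m - 1\<close> (\<open>modular_imp_Gumm_terms\<close>), which
  reduces the first part to the second. Day's terms \<open>d\<^sub>0, \<dots>, d\<^sub>m\<close> express \<open>m\<close>-modularity; nesting
  \<open>d\<^sub>1, \<dots>, d\<^bsub>m-1\<^esub>\<close> gives the term \<open>p\<close> with \<open>p(x, z, z) = x\<close>. It need not satisfy \<open>p(x, x, z) = z\<close>, but
  modulo \<open>\<alpha> \<inter> \<beta>\<close> and \<open>\<alpha> \<inter> \<gamma>\<close> the two sides are connected by \<open>m - 1\<close> applications of \<open>m\<close>-modularity,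
  of \<open>m\<close> steps each, and these steps yield the \<open>j\<^sub>i\<close>.\<close>

section \<open>Alternating compositions\<close>

lemma alt_comp_map:
  assumes "\<And>x y. (x, y) \<in> \<beta> \<Longrightarrow> (h x, h y) \<in> \<beta>'" "\<And>x y. (x, y) \<in> \<gamma> \<Longrightarrow> (h x, h y) \<in> \<gamma>'"
    and "(x, y) \<in> alt_comp n \<beta> \<gamma>"
  shows "(h x, h y) \<in> alt_comp n \<beta>' \<gamma>'"
  using assms
proof (induction n arbitrary: x \<beta> \<gamma> \<beta>' \<gamma>')
  case (Suc n)
  from Suc.prems(3) obtain z where z: "(x, z) \<in> \<beta>" "(z, y) \<in> alt_comp n \<gamma> \<beta>" by auto
  have "(h z, h y) \<in> alt_comp n \<gamma>' \<beta>'"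
    by (rule Suc.IH[OF Suc.prems(2,1) z(2)])
  then show ?case using Suc.prems(1)[OF z(1)] by auto
qed simp

lemma alt_comp_add:
  "alt_comp (m + n) \<beta> \<gamma> =
     alt_comp m \<beta> \<gamma> O (if even m then alt_comp n \<beta> \<gamma> else alt_comp n \<gamma> \<beta>)"
  by (induction m arbitrary: \<beta> \<gamma>) (auto simp: O_assoc)

lemma alt_comp_snoc:
  "alt_comp (Suc n) \<beta> \<gamma> = alt_comp n \<beta> \<gamma> O (if even n then \<beta> else \<gamma>)"
  using alt_comp_add[of n "Suc 0" \<beta> \<gamma>] by (simp split: if_splits)

lemma alt_comp_merge:
  assumes "(x, y) \<in> alt_comp (Suc r) \<beta> \<gamma>"
    and "(y, z) \<in> (if even r then alt_comp (Suc n) \<beta> \<gamma> else alt_comp (Suc n) \<gamma> \<beta>)"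
    and "trans \<beta>" "trans \<gamma>"
  shows "(x, z) \<in> alt_comp (Suc r + n) \<beta> \<gamma>"
proof -
  let ?\<delta> = "if even r then \<beta> else \<gamma>"
  let ?T = "if even r then alt_comp n \<gamma> \<beta> else alt_comp n \<beta> \<gamma>"
  obtain u where u: "(x, u) \<in> alt_comp r \<beta> \<gamma>" "(u, y) \<in> ?\<delta>"
    using assms(1) unfolding alt_comp_snoc by auto
  obtain w where w: "(y, w) \<in> ?\<delta>" "(w, z) \<in> ?T"
    using assms(2) by (auto split: if_splits)
  have "(u, w) \<in> ?\<delta>" using u(2) w(1) assms(3,4) by (auto split: if_splits dest: transD)
  then have "(x, w) \<in> alt_comp (Suc r) \<beta> \<gamma>" using u(1) unfolding alt_comp_snoc by auto
  then show ?thesis using w(2) unfolding alt_comp_add[of "Suc r" n] by (auto split: if_splits)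
qed

lemma converse_alt_comp:
  assumes "sym \<beta>" "sym \<gamma>"
  shows "(alt_comp n \<beta> \<gamma>)\<inverse> = (if even n then alt_comp n \<gamma> \<beta> else alt_comp n \<beta> \<gamma>)"
  using assms
proof (induction n arbitrary: \<beta> \<gamma>)
  case (Suc n)
  have "(alt_comp (Suc n) \<beta> \<gamma>)\<inverse> = (alt_comp n \<gamma> \<beta>)\<inverse> O \<beta>"
    using Suc.prems by (simp add: converse_relcomp sym_conv_converse_eq)
  also have "\<dots> = (if even (Suc n) then alt_comp (Suc n) \<gamma> \<beta> else alt_comp (Suc n) \<beta> \<gamma>)"
    unfolding Suc.IH[OF Suc.prems(2,1)] alt_comp_snoc by auto
  finally show ?case .
qed simp

lemma alt_comp_chain:
  assumes "(x, y) \<in> alt_comp n \<beta> \<gamma>"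
  obtains e where "e 0 = x" "e n = y" "\<forall>i<n. (e i, e (Suc i)) \<in> (if even i then \<beta> else \<gamma>)"
proof -
  have "\<exists>e. e 0 = x \<and> e n = y \<and> (\<forall>i<n. (e i, e (Suc i)) \<in> (if even i then \<beta> else \<gamma>))"
    using assms
  proof (induction n arbitrary: y)
    case (Suc n)
    then obtain z where z: "(x, z) \<in> alt_comp n \<beta> \<gamma>" "(z, y) \<in> (if even n then \<beta> else \<gamma>)"
      unfolding alt_comp_snoc by auto
    obtain e where "e 0 = x" "e n = z"
      "\<forall>i<n. (e i, e (Suc i)) \<in> (if even i then \<beta> else \<gamma>)" using Suc.IH[OF z(1)] by auto
    then show ?case using z(2)
      by (intro exI[of _ "e(Suc n := y)"]) (auto simp: less_Suc_eq)
  qed auto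
  then show thesis using that by blast
qed

section \<open>Congruences\<close>

lemma ConD:
  assumes "\<theta> \<in> Con F A"
  shows Con_carrier: "(x, y) \<in> \<theta> \<Longrightarrow> x \<in> univ A \<and> y \<in> univ A"
    and Con_refl: "x \<in> univ A \<Longrightarrow> (x, x) \<in> \<theta>"
    and Con_sym: "(x, y) \<in> \<theta> \<Longrightarrow> (y, x) \<in> \<theta>"
    and Con_trans: "(x, y) \<in> \<theta> \<Longrightarrow> (y, z) \<in> \<theta> \<Longrightarrow> (x, z) \<in> \<theta>"
    and Con_is_sym: "sym \<theta>" and Con_is_trans: "trans \<theta>"
    and Con_compat: "(f, length xs) \<in> F \<Longrightarrow> list_all2 (\<lambda>x y. (x, y) \<in> \<theta>) xs ys \<Longrightarrow>
      (interp A f xs, interp A f ys) \<in> \<theta>"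
proof -
  have "equiv (univ A) \<theta>" and compat: "\<forall>(f, n)\<in>F. \<forall>xs ys. length xs = n \<and>
      list_all2 (\<lambda>x y. (x, y) \<in> \<theta>) xs ys \<longrightarrow> (interp A f xs, interp A f ys) \<in> \<theta>"
    using assms unfolding Con_def by auto
  then have sub: "\<theta> \<subseteq> univ A \<times> univ A" and refl: "refl_on (univ A) \<theta>"
    and sym: "sym \<theta>" and trans: "trans \<theta>"
    unfolding equiv_def by auto
  show "sym \<theta>" "trans \<theta>" by (fact sym, fact trans)
  show "(x, y) \<in> \<theta> \<Longrightarrow> x \<in> univ A \<and> y \<in> univ A" using sub by auto
  show "x \<in> univ A \<Longrightarrow> (x, x) \<in> \<theta>" using refl by (rule refl_onD)
  show "(x, y) \<in> \<theta> \<Longrightarrow> (y, x) \<in> \<theta>" using sym by (rule symD)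
  show "(x, y) \<in> \<theta> \<Longrightarrow> (y, z) \<in> \<theta> \<Longrightarrow> (x, z) \<in> \<theta>" using trans by (rule transD)
  show "(f, length xs) \<in> F \<Longrightarrow> list_all2 (\<lambda>x y. (x, y) \<in> \<theta>) xs ys \<Longrightarrow>
      (interp A f xs, interp A f ys) \<in> \<theta>" using compat by blast
qed

lemma ConI:
  assumes "\<And>x y. (x, y) \<in> \<theta> \<Longrightarrow> x \<in> univ A \<and> y \<in> univ A"
    and "\<And>x. x \<in> univ A \<Longrightarrow> (x, x) \<in> \<theta>"
    and "\<And>x y. (x, y) \<in> \<theta> \<Longrightarrow> (y, x) \<in> \<theta>"
    and "\<And>x y z. (x, y) \<in> \<theta> \<Longrightarrow> (y, z) \<in> \<theta> \<Longrightarrow> (x, z) \<in> \<theta>"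
    and "\<And>f xs ys. (f, length xs) \<in> F \<Longrightarrow> list_all2 (\<lambda>x y. (x, y) \<in> \<theta>) xs ys \<Longrightarrow>
      (interp A f xs, interp A f ys) \<in> \<theta>"
  shows "\<theta> \<in> Con F A"
proof -
  have "equiv (univ A) \<theta>"
    unfolding equiv_def refl_on_def sym_def trans_def
    using assms(1,2) by (intro conjI) (auto intro: assms(3) assms(4))
  moreover have "\<forall>(f, n)\<in>F. \<forall>xs ys. length xs = n \<and> list_all2 (\<lambda>x y. (x, y) \<in> \<theta>) xs ys
      \<longrightarrow> (interp A f xs, interp A f ys) \<in> \<theta>"
    by (auto intro: assms(5))
  ultimately show ?thesis unfolding Con_def by blast
qed

lemma Con_Int:
  assumes \<alpha>: "\<alpha> \<in> Con F A" and \<beta>: "\<beta> \<in> Con F A"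
  shows "\<alpha> \<inter> \<beta> \<in> Con F A"
proof (rule ConI)
  fix f xs ys assume f: "(f, length xs) \<in> F" and "list_all2 (\<lambda>x y. (x, y) \<in> \<alpha> \<inter> \<beta>) xs ys"
  then have "list_all2 (\<lambda>x y. (x, y) \<in> \<alpha>) xs ys" "list_all2 (\<lambda>x y. (x, y) \<in> \<beta>) xs ys"
    by (auto elim: list_all2_mono)
  then show "(interp A f xs, interp A f ys) \<in> \<alpha> \<inter> \<beta>"
    using Con_compat[OF \<alpha> f] Con_compat[OF \<beta> f] by blast
next
  fix x y z assume "(x, y) \<in> \<alpha> \<inter> \<beta>" "(y, z) \<in> \<alpha> \<inter> \<beta>"
  then show "(x, z) \<in> \<alpha> \<inter> \<beta>" using Con_trans[OF \<alpha>] Con_trans[OF \<beta>] by blast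
next
  fix x y assume "(x, y) \<in> \<alpha> \<inter> \<beta>"
  then show "(y, x) \<in> \<alpha> \<inter> \<beta>" using Con_sym[OF \<alpha>] Con_sym[OF \<beta>] by blast
next
  fix x y assume "(x, y) \<in> \<alpha> \<inter> \<beta>"
  then show "x \<in> univ A \<and> y \<in> univ A" using Con_carrier[OF \<alpha>] by blast
next
  fix x assume "x \<in> univ A"
  then show "(x, x) \<in> \<alpha> \<inter> \<beta>" using Con_refl[OF \<alpha>] Con_refl[OF \<beta>] by blast
qed

lemma trm_val_Con:
  assumes \<theta>: "\<theta> \<in> Con F A" and v: "\<And>i. (v i, w i) \<in> \<theta>" and "wf_trm F t"
  shows "(trm_val A v t, trm_val A w t) \<in> \<theta>"
  using assms(3)
proof (induction t)
  case (App f ts)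
  then have "list_all2 (\<lambda>x y. (x, y) \<in> \<theta>) (map (trm_val A v) ts) (map (trm_val A w) ts)"
    by (auto simp: list_all2_conv_all_nth)
  then show ?case using App.prems Con_compat[OF \<theta>, of f "map (trm_val A v) ts"] by simp
qed (use v in simp)

lemma trm_val_univ:
  assumes A: "algebra F A" and v: "range v \<subseteq> univ A" and "wf_trm F t"
  shows "trm_val A v t \<in> univ A"
  using assms(3)
proof (induction t)
  case (App f ts)
  then have "set (map (trm_val A v) ts) \<subseteq> univ A" by auto
  then show ?case using App.prems A unfolding algebra_def by auto
qed (use v in auto)

lemma alt_comp_carrier:
  assumes \<beta>: "\<beta> \<in> Con F A" and \<gamma>: "\<gamma> \<in> Con F A" and "(x, y) \<in> alt_comp n \<beta> \<gamma>" and "x \<in> univ A"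
  shows "y \<in> univ A"
  using assms
proof (induction n arbitrary: x \<beta> \<gamma>)
  case (Suc n)
  then show ?case by (auto dest: Con_carrier)
qed simp

lemma alt_comp_refl:
  assumes "\<beta> \<in> Con F A" "\<gamma> \<in> Con F A" "x \<in> univ A"
  shows "(x, x) \<in> alt_comp n \<beta> \<gamma>"
  using assms by (induction n arbitrary: \<beta> \<gamma>) (auto dest: Con_refl)

lemma alt_comp_pad:
  assumes \<beta>: "\<beta> \<in> Con F A" and \<gamma>: "\<gamma> \<in> Con F A"
    and xy: "(x, y) \<in> alt_comp m \<beta> \<gamma>" and x: "x \<in> univ A" and le: "m \<le> n"
  shows "(x, y) \<in> alt_comp n \<beta> \<gamma>"
proof -
  have "y \<in> univ A" by (rule alt_comp_carrier[OF \<beta> \<gamma> xy x])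
  then show ?thesis
    using xy alt_comp_refl[OF \<beta> \<gamma>] alt_comp_refl[OF \<gamma> \<beta>] le alt_comp_add[of m "n - m" \<beta> \<gamma>]
    by (auto split: if_splits)
qed

lemma alt_comp_compat:
  assumes "\<beta> \<in> Con F A" "\<gamma> \<in> Con F A" "(f, length xs) \<in> F"
    and "list_all2 (\<lambda>x y. (x, y) \<in> alt_comp n \<beta> \<gamma>) xs ys"
  shows "(interp A f xs, interp A f ys) \<in> alt_comp n \<beta> \<gamma>"
  using assms
proof (induction n arbitrary: xs \<beta> \<gamma>)
  case 0
  then show ?case by (simp add: list_all2_eq[symmetric])
next
  case (Suc n)
  have "(\<lambda>x y. (x, y) \<in> alt_comp (Suc n) \<beta> \<gamma>) =
      (\<lambda>x y. (x, y) \<in> \<beta>) OO (\<lambda>x y. (x, y) \<in> alt_comp n \<gamma> \<beta>)"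
    by (auto simp: fun_eq_iff)
  then obtain zs where zs: "list_all2 (\<lambda>x y. (x, y) \<in> \<beta>) xs zs"
    "list_all2 (\<lambda>x y. (x, y) \<in> alt_comp n \<gamma> \<beta>) zs ys"
    using Suc.prems(4) by (auto simp: list.rel_compp)
  have "(f, length zs) \<in> F" using Suc.prems(3) list_all2_lengthD[OF zs(1)] by simp
  then show ?case
    using Suc.IH[OF Suc.prems(2,1) _ zs(2)] Con_compat[OF Suc.prems(1,3) zs(1)] by auto
qed

text \<open>The relations \<open>alt_comp n \<beta> \<gamma>\<close> increase with \<open>n\<close>. An operation has finitely
  many arguments, so a common \<open>n\<close> works for all of them, and the union is a congruence above \<open>\<beta>\<close> and \<open>\<gamma>\<close>.\<close>

lemma con_join_alt_comp:
  assumes \<beta>: "\<beta> \<in> Con F A" and \<gamma>: "\<gamma> \<in> Con F A" and "(x, y) \<in> con_join F A \<beta> \<gamma>"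
  shows "x \<in> univ A \<and> (\<exists>n. (x, y) \<in> alt_comp n \<beta> \<gamma>)"
proof -
  define S where "S = {(x, y). x \<in> univ A \<and> (\<exists>n. (x, y) \<in> alt_comp n \<beta> \<gamma>)}"
  have "S \<in> Con F A"
  proof (rule ConI)
    show carrier: "x \<in> univ A \<and> y \<in> univ A" if "(x, y) \<in> S" for x y
      using that alt_comp_carrier[OF \<beta> \<gamma>] unfolding S_def by blast
    show "(x, x) \<in> S" if "x \<in> univ A" for x
      using that unfolding S_def by (auto intro!: exI[of _ 0])
    show "(y, x) \<in> S" if xy: "(x, y) \<in> S" for x y
    proof -
      from xy obtain n where "(x, y) \<in> alt_comp n \<beta> \<gamma>" unfolding S_def by auto
      then have "(y, x) \<in> (if even n then alt_comp n \<gamma> \<beta> else alt_comp n \<beta> \<gamma>)"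
        using converse_alt_comp[OF Con_is_sym[OF \<beta>] Con_is_sym[OF \<gamma>], of n] by auto
      moreover have "(y, x) \<in> alt_comp (Suc n) \<beta> \<gamma>" if "(y, x) \<in> alt_comp n \<gamma> \<beta>"
        using that Con_refl[OF \<beta>] carrier[OF xy] by auto
      ultimately have "\<exists>n. (y, x) \<in> alt_comp n \<beta> \<gamma>" by (metis (full_types))
      then show ?thesis using carrier[OF xy] unfolding S_def by simp
    qed
    show "(x, z) \<in> S" if xy: "(x, y) \<in> S" and yz: "(y, z) \<in> S" for x y z
    proof -
      obtain m n where m: "(x, y) \<in> alt_comp m \<beta> \<gamma>" and n: "(y, z) \<in> alt_comp n \<beta> \<gamma>"
        using xy yz unfolding S_def by auto
      have "(x, y) \<in> alt_comp (2 * m) \<beta> \<gamma>"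
        using alt_comp_pad[OF \<beta> \<gamma> m] carrier[OF xy] by simp
      then have "(x, z) \<in> alt_comp (2 * m + n) \<beta> \<gamma>" using n unfolding alt_comp_add by auto
      then show ?thesis using carrier[OF xy] unfolding S_def by blast
    qed
    show "(interp A f xs, interp A f ys) \<in> S"
      if f: "(f, length xs) \<in> F" and xs: "list_all2 (\<lambda>x y. (x, y) \<in> S) xs ys" for f xs ys
    proof -
      from xs have "\<exists>n. list_all2 (\<lambda>x y. (x, y) \<in> alt_comp n \<beta> \<gamma> \<and> x \<in> univ A) xs ys"
      proof (induction rule: list_all2_induct)
        case (Cons x xs y ys)
        obtain m where m: "(x, y) \<in> alt_comp m \<beta> \<gamma>" and x: "x \<in> univ A"
          using Cons unfolding S_def by auto
        obtain n where "list_all2 (\<lambda>x y. (x, y) \<in> alt_comp n \<beta> \<gamma> \<and> x \<in> univ A) xs ys"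
          using Cons by auto
        then have "list_all2 (\<lambda>x y. (x, y) \<in> alt_comp (max m n) \<beta> \<gamma> \<and> x \<in> univ A) xs ys"
          by (auto elim!: list_all2_mono intro: alt_comp_pad[OF \<beta> \<gamma>])
        then show ?case using alt_comp_pad[OF \<beta> \<gamma> m x, of "max m n"] x by auto
      qed simp
      then obtain n where n: "list_all2 (\<lambda>x y. (x, y) \<in> alt_comp n \<beta> \<gamma>) xs ys"
        using list_all2_mono by force
      have "list_all2 (\<lambda>x y. (x, y) \<in> \<beta>) xs xs"
        using xs Con_refl[OF \<beta>] unfolding S_def by (auto simp: list_all2_conv_all_nth)
      then have "interp A f xs \<in> univ A"
        using Con_compat[OF \<beta> f] Con_carrier[OF \<beta>] by blast
      then show ?thesis using alt_comp_compat[OF \<beta> \<gamma> f n] unfolding S_def by blast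
    qed
  qed
  moreover have "\<beta> \<subseteq> S"
    using Con_carrier[OF \<beta>] unfolding S_def by (auto intro!: exI[of _ "Suc 0"])
  moreover have "(x, y) \<in> S" if "(x, y) \<in> \<gamma>" for x y
  proof -
    have "x \<in> univ A" using Con_carrier[OF \<gamma> that] by simp
    moreover from this have "(x, x) \<in> \<beta>" by (rule Con_refl[OF \<beta>])
    then have "(x, y) \<in> alt_comp (Suc (Suc 0)) \<beta> \<gamma>" using that by auto
    ultimately show ?thesis unfolding S_def by blast
  qed
  then have "\<gamma> \<subseteq> S" by (rule subrelI)
  ultimately have "con_join F A \<beta> \<gamma> \<subseteq> S"
    unfolding con_join_def by (intro Inter_lower) simp
  then have "(x, y) \<in> S" using assms(3) by (rule subsetD)
  then show ?thesis unfolding S_def by simp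
qed

section \<open>A free algebra inside the given universe\<close>

definition terms :: "('f \<times> nat) set \<Rightarrow> nat set \<Rightarrow> 'f trm set" where
  "terms F X = {t. wf_trm F t \<and> vars t \<subseteq> X}"

text \<open>With \<open>P = (\<lambda>v. True)\<close> these are the identities of \<open>V\<close>. If \<open>P\<close> says that certain variables
  take equal values, they are the pairs of terms that \<open>V\<close> identifies once these variables are
  identified. Stating this through valuations instead of substitutions makes it obvious that every
  \<open>P\<close> yields a congruence of the term algebra.\<close>

definition constrained_identities ::
  "('f, 'u) algebra set \<Rightarrow> ((nat \<Rightarrow> 'u) \<Rightarrow> bool) \<Rightarrow> 'f trm rel" where
  "constrained_identities V P =
     {(s, t). \<forall>A\<in>V. \<forall>v. range v \<subseteq> univ A \<longrightarrow> P v \<longrightarrow> trm_val A v s = trm_val A v t}"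

lemma constrained_identitiesD:
  "(s, t) \<in> constrained_identities V P \<Longrightarrow> A \<in> V \<Longrightarrow> range v \<subseteq> univ A \<Longrightarrow> P v \<Longrightarrow>
     trm_val A v s = trm_val A v t"
  unfolding constrained_identities_def by blast

primrec subst :: "(nat \<Rightarrow> 'f trm) \<Rightarrow> 'f trm \<Rightarrow> 'f trm" where
  "subst \<tau> (Var i) = \<tau> i"
| "subst \<tau> (App f ts) = App f (map (subst \<tau>) ts)"

lemma trm_val_subst: "trm_val A v (subst \<tau> t) = trm_val A (\<lambda>i. trm_val A v (\<tau> i)) t"
  by (induction t) (auto simp: comp_def cong: map_cong)

lemma subst_terms:
  assumes "\<And>i. \<tau> i \<in> terms F X" and "wf_trm F t"
  shows "subst \<tau> t \<in> terms F X"
  using assms(2)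
proof (induction t)
  case (App f ts)
  then have "\<forall>t\<in>set ts. subst \<tau> t \<in> terms F X" by simp
  then show ?case using App.prems unfolding terms_def by auto
qed (use assms(1) in simp)

text \<open>The carrier is the image of a choice \<open>q\<close> of codes for the terms, where two terms get the same
  code iff \<open>V\<close> satisfies the identity between them: the algebra generated by \<open>X\<close> that is free over
  \<open>V\<close>, realised in the type \<open>'u\<close>, so that it is a member of \<open>V\<close>.\<close>

locale free_algebra =
  fixes F :: "('f \<times> nat) set" and V :: "('f, 'u) algebra set" and X :: "nat set"
    and q :: "'f trm \<Rightarrow> 'u"
  assumes variety: "variety F V" and nonempty: "X \<noteq> {}"
    and q_eq_iff: "s \<in> terms F X \<Longrightarrow> t \<in> terms F X \<Longrightarrow>
      q s = q t \<longleftrightarrow> (s, t) \<in> constrained_identities V (\<lambda>v. True)"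
begin

definition rep :: "'u \<Rightarrow> 'f trm" where
  "rep x = (SOME t. t \<in> terms F X \<and> q t = x)"

definition Fr :: "('f, 'u) algebra" where
  "Fr = \<lparr>univ = q ` terms F X, interp = (\<lambda>f xs. q (App f (map rep xs)))\<rparr>"

definition Ker :: "((nat \<Rightarrow> 'u) \<Rightarrow> bool) \<Rightarrow> 'u rel" where
  "Ker P = {(x, y). x \<in> univ Fr \<and> y \<in> univ Fr \<and> (rep x, rep y) \<in> constrained_identities V P}"

lemma univ_Fr: "univ Fr = q ` terms F X"
  and interp_Fr: "interp Fr f xs = q (App f (map rep xs))"
  unfolding Fr_def by simp_all

lemma rep: "x \<in> univ Fr \<Longrightarrow> rep x \<in> terms F X \<and> q (rep x) = x"
  unfolding rep_def univ_Fr by (rule someI_ex) auto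

lemma rep_q:
  assumes "t \<in> terms F X" "A \<in> V" "range v \<subseteq> univ A"
  shows "trm_val A v (rep (q t)) = trm_val A v t"
proof -
  have "rep (q t) \<in> terms F X" "q (rep (q t)) = q t" using assms(1) rep univ_Fr by auto
  then have "(rep (q t), t) \<in> constrained_identities V (\<lambda>v. True)" using q_eq_iff assms(1) by simp
  then show ?thesis using assms(2,3) by (rule constrained_identitiesD) simp
qed

lemma App_rep_terms:
  assumes "(f, length xs) \<in> F" "set xs \<subseteq> univ Fr"
  shows "App f (map rep xs) \<in> terms F X"
  using assms rep unfolding terms_def by fastforce

lemma algebra_Fr: "algebra F Fr"
proof -
  have "univ Fr \<noteq> {}"
    using nonempty unfolding univ_Fr terms_def by (auto intro: exI[of _ "Var _"])
  then show ?thesis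
    unfolding algebra_def using App_rep_terms by (auto simp: interp_Fr) (auto simp: univ_Fr)
qed

lemma trm_val_Fr:
  assumes \<tau>: "\<And>i. \<tau> i \<in> terms F X" and "wf_trm F t"
  shows "trm_val Fr (\<lambda>i. q (\<tau> i)) t = q (subst \<tau> t)"
  using assms(2)
proof (induction t)
  case (App f ts)
  let ?l = "App f (map (\<lambda>t. rep (q (subst \<tau> t))) ts)" and ?r = "App f (map (subst \<tau>) ts)"
  have ts: "\<forall>t\<in>set ts. subst \<tau> t \<in> terms F X" using App.prems subst_terms[OF \<tau>] by auto
  have "trm_val Fr (\<lambda>i. q (\<tau> i)) (App f ts) = q ?l"
    using App by (auto simp: interp_Fr comp_def cong: map_cong)
  moreover have "?r \<in> terms F X" using subst_terms[OF \<tau> App.prems] by simp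
  moreover have "?l \<in> terms F X"
    using App_rep_terms[of f "map (\<lambda>t. q (subst \<tau> t)) ts"] App.prems ts
    by (auto simp: univ_Fr comp_def)
  moreover have "(?l, ?r) \<in> constrained_identities V (\<lambda>v. True)"
    unfolding constrained_identities_def using rep_q ts by (auto simp: comp_def cong: map_cong)
  ultimately show ?case using q_eq_iff by simp
qed simp

lemma Fr_in_V: "Fr \<in> V"
proof -
  from variety obtain E where E: "\<forall>(s, t)\<in>E. wf_trm F s \<and> wf_trm F t"
    "V = {A. algebra F A \<and> (\<forall>e\<in>E. satisfies A e)}" unfolding variety_def by auto
  have "satisfies Fr (s, t)" if st: "(s, t) \<in> E" for s t
    unfolding satisfies_def
  proof (intro allI impI)
    fix v :: "nat \<Rightarrow> 'u" assume v: "range v \<subseteq> univ Fr"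
    have \<tau>: "rep (v i) \<in> terms F X" for i using v rep by auto
    have v_eq: "v = (\<lambda>i. q (rep (v i)))" using v rep by (intro ext) (simp add: range_subsetD)
    have wf: "wf_trm F s" "wf_trm F t" using E(1) st by auto
    have "trm_val A w (subst (\<lambda>i. rep (v i)) s) = trm_val A w (subst (\<lambda>i. rep (v i)) t)"
      if A: "A \<in> V" and w: "range w \<subseteq> univ A" for A w
    proof -
      have "algebra F A" "satisfies A (s, t)" using A st unfolding E(2) by auto
      moreover have "range (\<lambda>i. trm_val A w (rep (v i))) \<subseteq> univ A"
        using trm_val_univ[OF \<open>algebra F A\<close> w] \<tau> unfolding terms_def by auto
      ultimately show ?thesis unfolding satisfies_def trm_val_subst by simp
    qed
    then have "(subst (\<lambda>i. rep (v i)) s, subst (\<lambda>i. rep (v i)) t)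
        \<in> constrained_identities V (\<lambda>v. True)"
      unfolding constrained_identities_def by simp
    then have "q (subst (\<lambda>i. rep (v i)) s) = q (subst (\<lambda>i. rep (v i)) t)"
      using q_eq_iff subst_terms[OF \<tau>] wf by simp
    then have "trm_val Fr (\<lambda>i. q (rep (v i))) s = trm_val Fr (\<lambda>i. q (rep (v i))) t"
      using trm_val_Fr[OF \<tau>] wf by simp
    then show "trm_val Fr v (fst (s, t)) = trm_val Fr v (snd (s, t))"
      using v_eq by simp
  qed
  then show ?thesis using algebra_Fr unfolding E(2) by auto
qed

lemma q_Ker_iff:
  assumes "s \<in> terms F X" "t \<in> terms F X"
  shows "(q s, q t) \<in> Ker P \<longleftrightarrow> (s, t) \<in> constrained_identities V P"
  using assms rep_q unfolding Ker_def univ_Fr constrained_identities_def by auto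

lemma Ker_Con: "Ker P \<in> Con F Fr"
proof (rule ConI)
  fix f xs ys assume f: "(f, length xs) \<in> F" and xs: "list_all2 (\<lambda>x y. (x, y) \<in> Ker P) xs ys"
  have len: "length ys = length xs" using list_all2_lengthD[OF xs] by simp
  have nth: "(xs ! i, ys ! i) \<in> Ker P" if "i < length xs" for i
    using list_all2_nthD[OF xs that] .
  have "set xs \<subseteq> univ Fr" "set ys \<subseteq> univ Fr"
    using nth len unfolding Ker_def by (auto simp: in_set_conv_nth)
  then have "App f (map rep xs) \<in> terms F X" "App f (map rep ys) \<in> terms F X"
    using App_rep_terms f len by auto
  moreover have "map (trm_val A v) (map rep xs) = map (trm_val A v) (map rep ys)"
    if "A \<in> V" "range v \<subseteq> univ A" "P v" for A v
    using nth len that by (intro nth_equalityI) (auto simp: Ker_def constrained_identities_def)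
  then have "(App f (map rep xs), App f (map rep ys)) \<in> constrained_identities V P"
    unfolding constrained_identities_def by simp
  ultimately show "(interp Fr f xs, interp Fr f ys) \<in> Ker P"
    unfolding interp_Fr using q_Ker_iff by simp
qed (auto simp: Ker_def constrained_identities_def)

lemma Ker_val:
  assumes "(x, y) \<in> Ker P" "A \<in> V" "range v \<subseteq> univ A" "P v"
  shows "trm_val A v (rep x) = trm_val A v (rep y)"
  using assms unfolding Ker_def by (auto dest: constrained_identitiesD)

text \<open>Moving the valuation \<open>v\<close> along \<open>\<theta>\<close> to the valuation \<open>w\<close>, which satisfies \<open>P\<close>, moves the values of
  the two terms along \<open>\<theta>\<close> to a common value. In this way a chain of kernel steps between generators
  of the free algebra becomes a chain of congruence steps in any member of \<open>V\<close>.\<close>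

lemma Ker_transfer:
  assumes A: "A \<in> V" and \<theta>: "\<theta> \<in> Con F A" and w: "P w" and vw: "\<And>i. (v i, w i) \<in> \<theta>"
    and xy: "(x, y) \<in> Ker P"
  shows "(trm_val A v (rep x), trm_val A v (rep y)) \<in> \<theta>"
proof -
  have wf: "wf_trm F (rep x)" "wf_trm F (rep y)"
    using xy rep unfolding Ker_def terms_def by auto
  have "range w \<subseteq> univ A" using vw Con_carrier[OF \<theta>] by auto
  then have "trm_val A w (rep x) = trm_val A w (rep y)"
    using Ker_val[OF xy A] w by simp
  moreover have "(trm_val A v (rep x), trm_val A w (rep x)) \<in> \<theta>"
    "(trm_val A v (rep y), trm_val A w (rep y)) \<in> \<theta>"
    using trm_val_Con[OF \<theta> vw] wf by auto
  ultimately show ?thesis using Con_sym[OF \<theta>] Con_trans[OF \<theta>] by metis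
qed

lemma Var_terms: "i \<in> X \<Longrightarrow> Var i \<in> terms F X"
  unfolding terms_def by simp

lemma Var_Ker:
  assumes "i \<in> X" "j \<in> X" "\<And>v. P v \<Longrightarrow> v i = v j"
  shows "(q (Var i), q (Var j)) \<in> Ker P"
  using assms by (auto simp: q_Ker_iff Var_terms constrained_identities_def)

end

text \<open>Terms are coded injectively by elements of \<open>'u\<close>, using that \<open>'u \<times> 'u\<close> embeds into the infinite
  type \<open>'u\<close>. The arity is part of the code of an operation symbol, so that the list of
  the codes of the arguments can be recovered from a code without an end marker.\<close>

lemma ex_inj_wf_trm:
  assumes inf: "infinite (UNIV :: 'u set)" and F: "F \<lesssim> (UNIV :: 'u set)"
  shows "\<exists>enc :: 'f trm \<Rightarrow> 'u. inj_on enc {t. wf_trm F t}"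
proof -
  obtain pr :: "'u \<times> 'u \<Rightarrow> 'u" where "bij_betw pr (UNIV \<times> UNIV) UNIV"
    using card_of_Times_same_infinite[OF inf] unfolding card_of_ordIso[symmetric] by blast
  then have "inj pr" by (simp add: bij_betw_def)
  then have pr: "pr (a, b) = pr (c, d) \<longleftrightarrow> a = c \<and> b = d" for a b c d
    by (auto dest: injD)
  obtain \<phi> :: "'f \<times> nat \<Rightarrow> 'u" where \<phi>: "inj_on \<phi> F" using F unfolding lepoll_def by auto
  obtain \<nu> :: "nat \<Rightarrow> 'u" where \<nu>: "inj \<nu>"
    using infinite_countable_subset[OF inf] by auto
  define enc_list :: "'u list \<Rightarrow> 'u" where "enc_list xs = foldr (\<lambda>x y. pr (x, y)) xs (\<nu> 0)" for xs
  have enc_list: "xs = ys" if "length xs = length ys" "enc_list xs = enc_list ys" for xs ys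
    using that unfolding enc_list_def by (induction rule: list_induct2) (auto simp: pr)
  define enc where "enc = rec_trm (\<lambda>i. pr (\<nu> 0, \<nu> i))
    (\<lambda>f ts. pr (\<nu> 1, pr (\<phi> (f, length ts), enc_list (map snd ts))))"
  have enc_simps: "enc (Var i) = pr (\<nu> 0, \<nu> i)"
    "enc (App f ts) = pr (\<nu> 1, pr (\<phi> (f, length ts), enc_list (map enc ts)))" for i f ts
    unfolding enc_def by (simp_all add: comp_def)
  have \<nu>_eq: "\<nu> i = \<nu> j \<longleftrightarrow> i = j" for i j using \<nu> by (auto dest: injD)
  have "s = t" if "wf_trm F s" "wf_trm F t" "enc s = enc t" for s t
    using that
  proof (induction s arbitrary: t)
    case (Var i)
    then show ?case by (cases t) (auto simp: enc_simps pr \<nu>_eq)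
  next
    case (App f ss)
    then obtain g ts where t: "t = App g ts" by (cases t) (auto simp: enc_simps pr \<nu>_eq)
    have "\<phi> (f, length ss) = \<phi> (g, length ts)" and l: "enc_list (map enc ss) = enc_list (map enc ts)"
      using App.prems(3) unfolding t by (auto simp: enc_simps pr)
    then have fg: "f = g" "length ss = length ts"
      using App.prems(1,2) \<phi> unfolding t by (auto dest!: inj_onD)
    then have "map enc ss = map enc ts" using enc_list l by simp
    then have eq: "enc (ss ! i) = enc (ts ! i)" if "i < length ss" for i
      using that fg(2) by (metis nth_map)
    have "ss = ts"
    proof (rule nth_equalityI[OF fg(2)])
      fix i assume i: "i < length ss"
      show "ss ! i = ts ! i"
        using i fg(2) App.prems(1,2) t by (intro App.IH eq) auto
    qed
    then show ?case using fg t by simp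
  qed
  then have "inj_on enc {t. wf_trm F t}" by (intro inj_onI) simp
  then show ?thesis by blast
qed

lemma ex_free_algebra:
  fixes F :: "('f \<times> nat) set" and V :: "('f, 'u) algebra set"
  assumes "infinite (UNIV :: 'u set)" "F \<lesssim> (UNIV :: 'u set)" "variety F V" "X \<noteq> {}"
  shows "\<exists>q. free_algebra F V X q"
proof -
  obtain enc :: "'f trm \<Rightarrow> 'u" where enc: "inj_on enc {t. wf_trm F t}"
    using ex_inj_wf_trm[OF assms(1,2)] by blast
  let ?I = "constrained_identities V (\<lambda>v. True)"
  define r where "r t = (SOME s. s \<in> terms F X \<and> (s, t) \<in> ?I)" for t
  have r: "r t \<in> terms F X" "(r t, t) \<in> ?I" if "t \<in> terms F X" for t
  proof -
    have "\<exists>s. s \<in> terms F X \<and> (s, t) \<in> ?I"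
      using that unfolding constrained_identities_def by auto
    then have "r t \<in> terms F X \<and> (r t, t) \<in> ?I" unfolding r_def by (rule someI_ex)
    then show "r t \<in> terms F X" "(r t, t) \<in> ?I" by simp_all
  qed
  have "enc (r s) = enc (r t) \<longleftrightarrow> (s, t) \<in> ?I" if s: "s \<in> terms F X" and t: "t \<in> terms F X" for s t
  proof
    assume "enc (r s) = enc (r t)"
    then have "r s = r t" using enc r(1)[OF s] r(1)[OF t] unfolding terms_def by (auto dest: inj_onD)
    then show "(s, t) \<in> ?I" using r(2)[OF s] r(2)[OF t] unfolding constrained_identities_def by simp
  next
    assume "(s, t) \<in> ?I"
    then have "(\<lambda>u. u \<in> terms F X \<and> (u, s) \<in> ?I) = (\<lambda>u. u \<in> terms F X \<and> (u, t) \<in> ?I)"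
      unfolding constrained_identities_def by (auto simp: fun_eq_iff)
    then show "enc (r s) = enc (r t)" unfolding r_def by simp
  qed
  then have "free_algebra F V X (\<lambda>t. enc (r t))" using assms by unfold_locales auto
  then show ?thesis by (intro exI[of _ "\<lambda>t. enc (r t)"])
qed

section \<open>Jonsson's theorem\<close>

definition val3 :: "'u \<Rightarrow> 'u \<Rightarrow> 'u \<Rightarrow> nat \<Rightarrow> 'u" where
  "val3 x y z i = (if i = 0 then x else if i = 1 then y else z)"

lemma ternary_op_val3: "ternary_op A t x y z = trm_val A (val3 x y z) t"
  unfolding ternary_op_def val3_def by simp

lemma range_val3: "x \<in> U \<Longrightarrow> y \<in> U \<Longrightarrow> z \<in> U \<Longrightarrow> range (val3 x y z) \<subseteq> U"
  unfolding val3_def by auto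

lemma val3_Con:
  "(x, x') \<in> \<theta> \<Longrightarrow> (y, y') \<in> \<theta> \<Longrightarrow> (z, z') \<in> \<theta> \<Longrightarrow> (val3 x y z i, val3 x' y' z' i) \<in> \<theta>"
  unfolding val3_def by simp

lemma ternary_op_Con:
  assumes "\<theta> \<in> Con F A" "wf_trm F t" "(x, x') \<in> \<theta>" "(y, y') \<in> \<theta>" "(z, z') \<in> \<theta>"
  shows "(ternary_op A t x y z, ternary_op A t x' y' z') \<in> \<theta>"
  unfolding ternary_op_val3 using assms by (intro trm_val_Con val3_Con)

lemma inclusion_holdsD:
  assumes "inclusion_holds F V L R" "A \<in> V" "\<alpha> \<in> Con F A" "\<beta> \<in> Con F A" "\<gamma> \<in> Con F A"
    and "p \<in> L \<alpha> \<beta> \<gamma>"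
  shows "p \<in> R \<alpha> \<beta> \<gamma>"
  using assms unfolding inclusion_holds_def by blast

lemma congruence_distributiveD:
  assumes "congruence_distributive F V" "A \<in> V" "\<alpha> \<in> Con F A" "\<beta> \<in> Con F A" "\<gamma> \<in> Con F A"
  shows "\<alpha> \<inter> con_join F A \<beta> \<gamma> = con_join F A (\<alpha> \<inter> \<beta>) (\<alpha> \<inter> \<gamma>)"
  using assms unfolding congruence_distributive_def by simp

text \<open>In the algebra that is free over the generators 0, 1, 2, let \<open>\<alpha>\<close>, \<open>\<beta>\<close>, \<open>\<gamma>\<close> be the kernels that
  identify 0 with 2, 0 with 1 and 1 with 2. By distributivity the pair (0, 2) of generators is in the
  join of \<open>\<alpha> \<inter> \<beta>\<close> and \<open>\<alpha> \<inter> \<gamma>\<close>, hence in some \<open>alt_comp n (\<alpha> \<inter> \<beta>) (\<alpha> \<inter> \<gamma>)\<close>; the chain of terms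
  witnessing it can be evaluated anywhere. This makes the least numbers \<open>J F V 1\<close> and
  \<open>J_smile F V 1\<close> attained.\<close>

theorem congruence_distributive_imp_Jonsson:
  fixes F :: "('f \<times> nat) set" and V :: "('f, 'u) algebra set"
  assumes inf: "infinite (UNIV :: 'u set)" and F: "F \<lesssim> (UNIV :: 'u set)"
    and V: "variety F V" and CD: "congruence_distributive F V"
  shows "\<exists>n. inclusion_holds F V (\<lambda>\<alpha> \<beta> \<gamma>. \<alpha> \<inter> (\<beta> O \<gamma>))
     (\<lambda>\<alpha> \<beta> \<gamma>. alt_comp n (\<alpha> \<inter> \<beta>) (\<alpha> \<inter> \<gamma>))"
proof -
  obtain q :: "'f trm \<Rightarrow> 'u" where "free_algebra F V {0, 1, 2} q"
    using ex_free_algebra[OF inf F V, of "{0, 1, 2}"] by auto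
  then interpret free_algebra F V "{0, 1, 2}" q .
  let ?P = "\<lambda>v :: nat \<Rightarrow> 'u. v 0 = v 2" and ?Q = "\<lambda>v :: nat \<Rightarrow> 'u. v 0 = v 1"
    and ?R = "\<lambda>v :: nat \<Rightarrow> 'u. v 1 = v 2"
  let ?x = "q (Var 0)" and ?z = "q (Var 2)"
  have in_above: "(?x, ?z) \<in> \<theta>" if \<theta>: "\<theta> \<in> Con F Fr" and sub: "Ker ?Q \<union> Ker ?R \<subseteq> \<theta>" for \<theta>
  proof -
    have "(?x, q (Var 1)) \<in> Ker ?Q" "(q (Var 1), ?z) \<in> Ker ?R"
      by (rule Var_Ker; simp)+
    then have "(?x, q (Var 1)) \<in> \<theta>" "(q (Var 1), ?z) \<in> \<theta>" using sub by auto
    then show ?thesis by (rule Con_trans[OF \<theta>])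
  qed
  have "(?x, ?z) \<in> con_join F Fr (Ker ?Q) (Ker ?R)"
    unfolding con_join_def by (intro InterI, elim CollectE conjE) (rule in_above)
  moreover have "(?x, ?z) \<in> Ker ?P" by (rule Var_Ker) simp_all
  ultimately have "(?x, ?z) \<in> Ker ?P \<inter> con_join F Fr (Ker ?Q) (Ker ?R)" by (rule IntI[rotated])
  also have "Ker ?P \<inter> con_join F Fr (Ker ?Q) (Ker ?R) =
      con_join F Fr (Ker ?P \<inter> Ker ?Q) (Ker ?P \<inter> Ker ?R)"
    by (rule congruence_distributiveD[OF CD Fr_in_V Ker_Con Ker_Con Ker_Con])
  finally have "(?x, ?z) \<in> con_join F Fr (Ker ?P \<inter> Ker ?Q) (Ker ?P \<inter> Ker ?R)" .
  from con_join_alt_comp[OF Con_Int[OF Ker_Con Ker_Con] Con_Int[OF Ker_Con Ker_Con] this]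
  obtain n where n: "(?x, ?z) \<in> alt_comp n (Ker ?P \<inter> Ker ?Q) (Ker ?P \<inter> Ker ?R)"
    by (elim conjE exE)
  have "(a, c) \<in> alt_comp n (\<alpha> \<inter> \<beta>) (\<alpha> \<inter> \<gamma>)"
    if A: "A \<in> V" and \<alpha>: "\<alpha> \<in> Con F A" and \<beta>: "\<beta> \<in> Con F A" and \<gamma>: "\<gamma> \<in> Con F A"
      and ac: "(a, c) \<in> \<alpha>" and ab: "(a, b) \<in> \<beta>" and bc: "(b, c) \<in> \<gamma>" for A \<alpha> \<beta> \<gamma> a b c
  proof -
    let ?h = "\<lambda>x. trm_val A (val3 a b c) (rep x)"
    have U: "a \<in> univ A" "b \<in> univ A" "c \<in> univ A"
      using Con_carrier[OF \<alpha> ac] Con_carrier[OF \<beta> ab] by auto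
    have \<alpha>_h: "(?h x, ?h y) \<in> \<alpha>" if "(x, y) \<in> Ker ?P" for x y
      by (rule Ker_transfer[where v = "val3 a b c" and w = "val3 a b a", OF A \<alpha> _ val3_Con that])
        (simp_all add: val3_def U ac Con_refl[OF \<alpha>] Con_sym[OF \<alpha> ac])
    have \<beta>_h: "(?h x, ?h y) \<in> \<beta>" if "(x, y) \<in> Ker ?Q" for x y
      by (rule Ker_transfer[where v = "val3 a b c" and w = "val3 a a c", OF A \<beta> _ val3_Con that])
        (simp_all add: val3_def U ab Con_refl[OF \<beta>] Con_sym[OF \<beta> ab])
    have \<gamma>_h: "(?h x, ?h y) \<in> \<gamma>" if "(x, y) \<in> Ker ?R" for x y
      by (rule Ker_transfer[where v = "val3 a b c" and w = "val3 a c c", OF A \<gamma> _ val3_Con that])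
        (simp_all add: val3_def U bc Con_refl[OF \<gamma>] Con_sym[OF \<gamma> bc])
    have "(?h ?x, ?h ?z) \<in> alt_comp n (\<alpha> \<inter> \<beta>) (\<alpha> \<inter> \<gamma>)"
    proof (rule alt_comp_map[OF _ _ n])
      show "(?h x, ?h y) \<in> \<alpha> \<inter> \<beta>" if "(x, y) \<in> Ker ?P \<inter> Ker ?Q" for x y
        using \<alpha>_h[OF IntD1[OF that]] \<beta>_h[OF IntD2[OF that]] by (rule IntI)
      show "(?h x, ?h y) \<in> \<alpha> \<inter> \<gamma>" if "(x, y) \<in> Ker ?P \<inter> Ker ?R" for x y
        using \<alpha>_h[OF IntD1[OF that]] \<gamma>_h[OF IntD2[OF that]] by (rule IntI)
    qed
    then show ?thesis
      using rep_q[OF Var_terms A range_val3[OF U]] by (simp add: val3_def)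
  qed
  note chain = this
  show ?thesis
    unfolding inclusion_holds_def
    by (intro exI[of _ n] ballI subrelI, elim IntE relcompEpair) (rule chain)
qed

lemma
  fixes F :: "('f \<times> nat) set" and V :: "('f, 'u) algebra set"
  assumes "infinite (UNIV :: 'u set)" "F \<lesssim> (UNIV :: 'u set)"
    "variety F V" "congruence_distributive F V"
  shows J_1_attained: "inclusion_holds F V (\<lambda>\<alpha> \<beta> \<gamma>. \<alpha> \<inter> (\<beta> O \<gamma>))
     (\<lambda>\<alpha> \<beta> \<gamma>. alt_comp (J F V 1 + 1) (\<alpha> \<inter> \<beta>) (\<alpha> \<inter> \<gamma>))" (is ?J)
  and J_smile_1_attained: "inclusion_holds F V (\<lambda>\<alpha> \<beta> \<gamma>. \<alpha> \<inter> (\<beta> O \<gamma>))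
     (\<lambda>\<alpha> \<beta> \<gamma>. alt_comp (J_smile F V 1 + 1) (\<alpha> \<inter> \<gamma>) (\<alpha> \<inter> \<beta>))" (is ?Js)
proof -
  have two: "alt_comp (1 + 1) \<beta> \<gamma> = \<beta> O \<gamma>" for \<beta> \<gamma> :: "'u rel" by simp
  obtain n where n: "inclusion_holds F V (\<lambda>\<alpha> \<beta> \<gamma>. \<alpha> \<inter> (\<beta> O \<gamma>))
     (\<lambda>\<alpha> \<beta> \<gamma>. alt_comp n (\<alpha> \<inter> \<beta>) (\<alpha> \<inter> \<gamma>))"
    using congruence_distributive_imp_Jonsson[OF assms] by blast
  have both: "p \<in> alt_comp (n + 1) (\<alpha> \<inter> \<beta>) (\<alpha> \<inter> \<gamma>) \<and> p \<in> alt_comp (n + 1) (\<alpha> \<inter> \<gamma>) (\<alpha> \<inter> \<beta>)"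
    if A: "A \<in> V" and \<alpha>: "\<alpha> \<in> Con F A" and \<beta>: "\<beta> \<in> Con F A" and \<gamma>: "\<gamma> \<in> Con F A"
      and p: "p \<in> \<alpha> \<inter> (\<beta> O \<gamma>)" for A \<alpha> \<beta> \<gamma> p
  proof -
    obtain x y where xy: "p = (x, y)" by (cases p)
    have *: "(x, y) \<in> alt_comp n (\<alpha> \<inter> \<beta>) (\<alpha> \<inter> \<gamma>)"
      using inclusion_holdsD[OF n A \<alpha> \<beta> \<gamma>, of p] p xy by blast
    have x: "x \<in> univ A" using p xy Con_carrier[OF \<alpha>] by blast
    note Int = Con_Int[OF \<alpha> \<beta>] Con_Int[OF \<alpha> \<gamma>]
    have "(x, x) \<in> \<alpha> \<inter> \<gamma>" using Con_refl[OF Int(2) x] .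
    then have "(x, y) \<in> alt_comp (n + 1) (\<alpha> \<inter> \<gamma>) (\<alpha> \<inter> \<beta>)" using * by auto
    then show ?thesis using alt_comp_pad[OF Int * x, of "n + 1"] xy by simp
  qed
  have n_J: "inclusion_holds F V (\<lambda>\<alpha> \<beta> \<gamma>. \<alpha> \<inter> (\<beta> O \<gamma>))
      (\<lambda>\<alpha> \<beta> \<gamma>. alt_comp (n + 1) (\<alpha> \<inter> \<beta>) (\<alpha> \<inter> \<gamma>))"
    unfolding inclusion_holds_def by (intro ballI subsetI) (rule both[THEN conjunct1])
  have n_Js: "inclusion_holds F V (\<lambda>\<alpha> \<beta> \<gamma>. \<alpha> \<inter> (\<beta> O \<gamma>))
      (\<lambda>\<alpha> \<beta> \<gamma>. alt_comp (n + 1) (\<alpha> \<inter> \<gamma>) (\<alpha> \<inter> \<beta>))"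
    unfolding inclusion_holds_def by (intro ballI subsetI) (rule both[THEN conjunct2])
  show ?J unfolding J_def two
    by (rule LeastI[of "\<lambda>k. inclusion_holds F V (\<lambda>\<alpha> \<beta> \<gamma>. \<alpha> \<inter> (\<beta> O \<gamma>))
        (\<lambda>\<alpha> \<beta> \<gamma>. alt_comp (k + 1) (\<alpha> \<inter> \<beta>) (\<alpha> \<inter> \<gamma>))", OF n_J])
  show ?Js unfolding J_smile_def two
    by (rule LeastI[of "\<lambda>k. inclusion_holds F V (\<lambda>\<alpha> \<beta> \<gamma>. \<alpha> \<inter> (\<beta> O \<gamma>))
        (\<lambda>\<alpha> \<beta> \<gamma>. alt_comp (k + 1) (\<alpha> \<inter> \<gamma>) (\<alpha> \<inter> \<beta>))", OF n_Js])
qed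

section \<open>From Gumm terms to bounds\<close>

lemma alt_comp_even_chain:
  assumes "\<And>i. i < k \<Longrightarrow> (g i, g (Suc i)) \<in> \<gamma> O \<beta>"
  shows "(g 0, g k) \<in> alt_comp (2 * k) \<gamma> \<beta>"
  using assms
proof (induction k)
  case (Suc k)
  then have "(g 0, g k) \<in> alt_comp (2 * k) \<gamma> \<beta>" "(g k, g (Suc k)) \<in> \<gamma> O \<beta>" by auto
  moreover have "alt_comp (2 * Suc k) \<gamma> \<beta> = alt_comp (2 * k) \<gamma> \<beta> O \<gamma> O \<beta>"
  proof -
    have "alt_comp (2 * k + 2) \<gamma> \<beta> = alt_comp (2 * k) \<gamma> \<beta> O alt_comp 2 \<gamma> \<beta>"
      unfolding alt_comp_add by simp
    moreover have "alt_comp 2 \<gamma> \<beta> = \<gamma> O \<beta>" by (simp add: numeral_2_eq_2)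
    moreover have "2 * Suc k = 2 * k + 2" by simp
    ultimately show ?thesis by metis
  qed
  ultimately show ?case by blast
qed simp

text \<open>Let \<open>a \<beta> b \<gamma> c \<beta> d\<close>. The intermediate element is \<open>j\<^sub>1(a, b, d)\<close>: on one side
  \<open>a = p(a, b, b) \<gamma> p(a, b, c) \<beta> p(a, a, d) = j\<^sub>1(a, a, d) \<beta> j\<^sub>1(a, b, d)\<close>. On the other side, the
  middle argument of the \<open>j\<^sub>i\<close> runs alternately from \<open>b\<close> to \<open>c\<close> and from \<open>c\<close> to \<open>b\<close>, which is a
  \<open>\<gamma>\<close>-step; in between, one \<open>\<beta>\<close>-step leads from \<open>j\<^sub>i\<close> to \<open>j\<^bsub>i+1\<^esub>\<close>, through the middle argument \<open>d\<close>
  (from and to \<open>c\<close>) for odd \<open>i\<close> and \<open>a\<close> (from and to \<open>b\<close>) for even \<open>i\<close>. All this happens in one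
  \<open>\<alpha>\<close>-class, since \<open>j\<^sub>i(a, y, d) \<alpha> j\<^sub>i(a, y, a) = a\<close>.\<close>

lemma Gumm_split:
  assumes gumm: "has_gumm_terms F V k" and A: "A \<in> V"
    and \<alpha>: "\<alpha> \<in> Con F A" and \<beta>: "\<beta> \<in> Con F A" and \<gamma>: "\<gamma> \<in> Con F A"
    and ad: "(a, d) \<in> \<alpha> \<inter> (\<beta> O \<gamma> O \<beta>)"
  shows "\<exists>e. (a, e) \<in> \<alpha> \<inter> (\<gamma> O \<beta>) \<and> (e, d) \<in> alt_comp (2 * k) (\<alpha> \<inter> \<gamma>) (\<alpha> \<inter> \<beta>)"
proof -
  obtain p j where "ternary_trm F p" "\<forall>i\<in>{1..k+1}. ternary_trm F (j i)"
    and ids: "\<forall>A\<in>V. \<forall>x\<in>univ A. \<forall>y\<in>univ A. \<forall>z\<in>univ A.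
          x = ternary_op A p x z z \<and>
          ternary_op A p x x z = ternary_op A (j 1) x x z \<and>
          (\<forall>i\<in>{1..k+1}. x = ternary_op A (j i) x y x) \<and>
          (\<forall>i\<in>{1..<k+1}. even i \<longrightarrow> ternary_op A (j i) x x z = ternary_op A (j (i + 1)) x x z) \<and>
          (\<forall>i\<in>{1..<k+1}. odd i \<longrightarrow> ternary_op A (j i) x z z = ternary_op A (j (i + 1)) x z z) \<and>
          ternary_op A (j (k + 1)) x y z = z"
    using gumm unfolding has_gumm_terms_def by blast
  then have wf: "wf_trm F p" "i \<in> {1..k+1} \<Longrightarrow> wf_trm F (j i)" for i
    unfolding ternary_trm_def by auto
  obtain b c where ab: "(a, b) \<in> \<beta>" and bc: "(b, c) \<in> \<gamma>" and cd: "(c, d) \<in> \<beta>" using ad by auto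
  have ad: "(a, d) \<in> \<alpha>" using ad by simp
  have U: "a \<in> univ A" "b \<in> univ A" "c \<in> univ A" "d \<in> univ A"
    using Con_carrier[OF \<beta> ab] Con_carrier[OF \<beta> cd] by auto
  have id3: "ternary_op A p x z z = x" "ternary_op A p x x z = ternary_op A (j 1) x x z"
      "\<And>i. i \<in> {1..k+1} \<Longrightarrow> ternary_op A (j i) x y x = x"
      "\<And>i. i \<in> {1..<k+1} \<Longrightarrow> even i \<Longrightarrow> ternary_op A (j i) x x z = ternary_op A (j (i + 1)) x x z"
      "\<And>i. i \<in> {1..<k+1} \<Longrightarrow> odd i \<Longrightarrow> ternary_op A (j i) x z z = ternary_op A (j (i + 1)) x z z"
      "ternary_op A (j (k + 1)) x y z = z"
    if "x \<in> univ A" "y \<in> univ A" "z \<in> univ A" for x y z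
    using bspec[OF bspec[OF bspec[OF bspec[OF ids A] that(1)] that(2)] that(3)] by metis+
  let ?p = "ternary_op A p" and ?j = "\<lambda>i. ternary_op A (j i)"
  have p1: "?p a b b = a" and p2: "?p a a d = ?j 1 a a d"
    and j_absorb: "\<And>i y. i \<in> {1..k+1} \<Longrightarrow> y \<in> univ A \<Longrightarrow> ?j i a y a = a"
    and j_even: "\<And>i. i \<in> {1..<k+1} \<Longrightarrow> even i \<Longrightarrow> ?j i a a d = ?j (i + 1) a a d"
    and j_odd: "\<And>i. i \<in> {1..<k+1} \<Longrightarrow> odd i \<Longrightarrow> ?j i a d d = ?j (i + 1) a d d"
    and j_last: "\<And>y. y \<in> univ A \<Longrightarrow> ?j (k + 1) a y d = d"
    using id3[OF U(1,2,2)] id3[OF U(1,4,4)] id3[OF U(1) _ U(1)] id3[OF U(1) _ U(4)] U by simp_all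
  have j_\<alpha>: "(?j i a y d, ?j i' a y' d) \<in> \<alpha>"
    if "i \<in> {1..k+1}" "i' \<in> {1..k+1}" "y \<in> univ A" "y' \<in> univ A" for i i' y y'
  proof -
    have from_a: "(a, ?j i a y d) \<in> \<alpha>" if "i \<in> {1..k+1}" "y \<in> univ A" for i y
      using ternary_op_Con[OF \<alpha> wf(2)[OF that(1)] Con_refl[OF \<alpha> U(1)] Con_refl[OF \<alpha> that(2)] ad]
        j_absorb[OF that] by simp
    show ?thesis
      using from_a[OF that(1,3)] from_a[OF that(2,4)] by (rule Con_trans[OF \<alpha> Con_sym[OF \<alpha>]])
  qed
  have j_mid: "(?j i a y d, ?j i a y' d) \<in> \<theta>"
    if "\<theta> \<in> Con F A" "i \<in> {1..k+1}" "(y, y') \<in> \<theta>" for \<theta> i y y'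
    using that ternary_op_Con[OF that(1) wf(2)[OF that(2)]] Con_refl[OF that(1)] U by simp
  have first: "(a, ?j 1 a b d) \<in> \<alpha> \<inter> (\<gamma> O \<beta>)"
  proof -
    have "(?p a b b, ?p a b c) \<in> \<gamma>"
      using ternary_op_Con[OF \<gamma> wf(1)] Con_refl[OF \<gamma>] U bc by simp
    moreover have "(?p a b c, ?p a a d) \<in> \<beta>"
      using ternary_op_Con[OF \<beta> wf(1)] Con_refl[OF \<beta>] Con_sym[OF \<beta> ab] U cd by simp
    moreover have "(?j 1 a a d, ?j 1 a b d) \<in> \<beta>" using j_mid[OF \<beta> _ ab] by simp
    ultimately have "(a, ?j 1 a b d) \<in> \<gamma> O \<beta>" unfolding p1 p2 using Con_trans[OF \<beta>] by blast
    moreover have "(?j 1 a b a, ?j 1 a b d) \<in> \<alpha>"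
      using ternary_op_Con[OF \<alpha> wf(2)] Con_refl[OF \<alpha>] U ad by simp
    ultimately show ?thesis using j_absorb[of 1 b] U by simp
  qed
  define g where "g i = ?j (Suc i) a (if even i then b else c) d" for i
  have "(g i, g (Suc i)) \<in> (\<alpha> \<inter> \<gamma>) O (\<alpha> \<inter> \<beta>)" if i: "i < k" for i
  proof -
    let ?y = "if even i then c else b" and ?e = "if even i then d else a"
    have in_range: "Suc i \<in> {1..k+1}" "Suc (Suc i) \<in> {1..k+1}" "Suc i \<in> {1..<k+1}" using i by auto
    have "(g i, ?j (Suc i) a ?y d) \<in> \<gamma>"
      unfolding g_def using j_mid[OF \<gamma> in_range(1)] bc Con_sym[OF \<gamma> bc] by simp
    moreover have "(g i, ?j (Suc i) a ?y d) \<in> \<alpha>"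
      unfolding g_def using j_\<alpha> in_range U by simp
    moreover have step1: "(?j (Suc i) a ?y d, ?j (Suc i) a ?e d) \<in> \<beta>"
      using j_mid[OF \<beta> in_range(1)] cd ab Con_sym[OF \<beta> cd] Con_sym[OF \<beta> ab] by simp
    have step2: "?j (Suc i) a ?e d = ?j (Suc (Suc i)) a ?e d"
      using j_even[OF in_range(3)] j_odd[OF in_range(3)] by simp
    have step3: "(?j (Suc (Suc i)) a ?e d, ?j (Suc (Suc i)) a ?y d) \<in> \<beta>"
      using j_mid[OF \<beta> in_range(2)] cd ab Con_sym[OF \<beta> cd] Con_sym[OF \<beta> ab] by simp
    have "(?j (Suc i) a ?y d, g (Suc i)) \<in> \<beta>"
      using Con_trans[OF \<beta> step1[unfolded step2] step3]
      unfolding g_def by (cases "even i") simp_all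
    moreover have "(?j (Suc i) a ?y d, g (Suc i)) \<in> \<alpha>"
      unfolding g_def using j_\<alpha> in_range U by simp
    ultimately show ?thesis by blast
  qed
  then have "(g 0, g k) \<in> alt_comp (2 * k) (\<alpha> \<inter> \<gamma>) (\<alpha> \<inter> \<beta>)" by (rule alt_comp_even_chain)
  moreover have "g 0 = ?j 1 a b d" "g k = d" unfolding g_def using j_last U by simp_all
  ultimately show ?thesis using first by auto
qed

lemma J_2_le:
  assumes "\<And>A \<alpha> \<beta> \<gamma> x y. A \<in> V \<Longrightarrow> \<alpha> \<in> Con F A \<Longrightarrow> \<beta> \<in> Con F A \<Longrightarrow> \<gamma> \<in> Con F A \<Longrightarrow>
    (x, y) \<in> \<alpha> \<inter> (\<beta> O \<gamma> O \<beta>) \<Longrightarrow> (x, y) \<in> alt_comp (n + 1) (\<alpha> \<inter> \<beta>) (\<alpha> \<inter> \<gamma>)"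
  shows "J F V 2 \<le> n"
proof -
  have "alt_comp (2 + 1) \<beta> \<gamma> = \<beta> O \<gamma> O \<beta>" for \<beta> \<gamma> :: "'b rel" by (simp add: numeral_2_eq_2)
  then show ?thesis
    unfolding J_def inclusion_holds_def by (intro Least_le ballI subrelI) (rule assms, auto)
qed

lemma J_smile_2_le:
  assumes "\<And>A \<alpha> \<beta> \<gamma> x y. A \<in> V \<Longrightarrow> \<alpha> \<in> Con F A \<Longrightarrow> \<beta> \<in> Con F A \<Longrightarrow> \<gamma> \<in> Con F A \<Longrightarrow>
    (x, y) \<in> \<alpha> \<inter> (\<beta> O \<gamma> O \<beta>) \<Longrightarrow> (x, y) \<in> alt_comp (n + 1) (\<alpha> \<inter> \<gamma>) (\<alpha> \<inter> \<beta>)"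
  shows "J_smile F V 2 \<le> n"
proof -
  have "alt_comp (2 + 1) \<beta> \<gamma> = \<beta> O \<gamma> O \<beta>" for \<beta> \<gamma> :: "'b rel" by (simp add: numeral_2_eq_2)
  then show ?thesis
    unfolding J_smile_def inclusion_holds_def by (intro Least_le ballI subrelI) (rule assms, auto)
qed

text \<open>The chain of length \<open>r + 1\<close> that the inclusion for \<open>\<alpha> \<inter> (\<gamma> O \<beta>)\<close> provides is followed by the
  chain of length \<open>2k\<close> from the terms \<open>j\<^sub>i\<close>. If the last factor of the former is the first factor of
  the latter, the two collapse by transitivity; the parity of \<open>r\<close> decides about this.\<close>

lemma alt_comp_join_chains:
  assumes B: "trans B" and C: "trans C"
    and xy: "(x, y) \<in> alt_comp (r + 1) B C" and yz: "(y, z) \<in> alt_comp (2 * k) D E"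
  shows "(D, E) = (if even r then (C, B) else (B, C)) \<Longrightarrow>
      (x, z) \<in> alt_comp (r + 2 * k + 1) B C"
    and "(D, E) = (if even r then (B, C) else (C, B)) \<Longrightarrow> k \<ge> 1 \<Longrightarrow>
      (x, z) \<in> alt_comp (r + 2 * k - 1 + 1) B C"
proof -
  assume "(D, E) = (if even r then (C, B) else (B, C))"
  then show "(x, z) \<in> alt_comp (r + 2 * k + 1) B C"
    using xy yz alt_comp_add[of "r + 1" "2 * k" B C] by (auto split: if_splits simp: add.commute)
next
  assume DE: "(D, E) = (if even r then (B, C) else (C, B))" and k: "k \<ge> 1"
  then have "2 * k = Suc (2 * k - 1)" by simp
  then have "(y, z) \<in> (if even r then alt_comp (Suc (2 * k - 1)) B C
      else alt_comp (Suc (2 * k - 1)) C B)"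
    using yz DE by (metis (full_types) prod.inject)
  then have "(x, z) \<in> alt_comp (Suc r + (2 * k - 1)) B C"
    by (rule alt_comp_merge[OF xy[folded Suc_eq_plus1] _ B C])
  moreover have "Suc r + (2 * k - 1) = r + 2 * k - 1 + 1" using k by simp
  ultimately show "(x, z) \<in> alt_comp (r + 2 * k - 1 + 1) B C" by metis
qed

theorem Gumm_bounds:
  fixes F :: "('f \<times> nat) set" and V :: "('f, 'u) algebra set"
  assumes hyps: "infinite (UNIV :: 'u set)" "F \<lesssim> (UNIV :: 'u set)"
    "variety F V" "congruence_distributive F V" and gumm: "has_gumm_terms F V k"
  shows "even (J_smile F V 1) \<or> k = 0 \<Longrightarrow> J F V 2 \<le> J_smile F V 1 + 2 * k"
    and "odd (J_smile F V 1) \<Longrightarrow> k \<ge> 1 \<Longrightarrow> J F V 2 \<le> J_smile F V 1 + 2 * k - 1"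
    and "odd (J F V 1) \<or> k = 0 \<Longrightarrow> J_smile F V 2 \<le> J F V 1 + 2 * k"
    and "even (J F V 1) \<Longrightarrow> k \<ge> 1 \<Longrightarrow> J_smile F V 2 \<le> J F V 1 + 2 * k - 1"
proof -
  note tr = Con_is_trans[OF Con_Int]
  have split: "\<exists>e. (x, e) \<in> alt_comp (J F V 1 + 1) (\<alpha> \<inter> \<gamma>) (\<alpha> \<inter> \<beta>) \<and>
      (x, e) \<in> alt_comp (J_smile F V 1 + 1) (\<alpha> \<inter> \<beta>) (\<alpha> \<inter> \<gamma>) \<and>
      (e, y) \<in> alt_comp (2 * k) (\<alpha> \<inter> \<gamma>) (\<alpha> \<inter> \<beta>)"
    if A: "A \<in> V" and \<alpha>: "\<alpha> \<in> Con F A" and \<beta>: "\<beta> \<in> Con F A" and \<gamma>: "\<gamma> \<in> Con F A"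
      and xy: "(x, y) \<in> \<alpha> \<inter> (\<beta> O \<gamma> O \<beta>)" for A \<alpha> \<beta> \<gamma> x y
  proof -
    obtain e where e: "(x, e) \<in> \<alpha> \<inter> (\<gamma> O \<beta>)"
      "(e, y) \<in> alt_comp (2 * k) (\<alpha> \<inter> \<gamma>) (\<alpha> \<inter> \<beta>)"
      using Gumm_split[OF gumm A \<alpha> \<beta> \<gamma> xy] by blast
    show ?thesis
      using inclusion_holdsD[OF J_1_attained[OF hyps] A \<alpha> \<gamma> \<beta> e(1)]
        inclusion_holdsD[OF J_smile_1_attained[OF hyps] A \<alpha> \<gamma> \<beta> e(1)] e(2)
      by (intro exI[of _ e] conjI)
  qed
  show "J F V 2 \<le> J_smile F V 1 + 2 * k" if "even (J_smile F V 1) \<or> k = 0"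
  proof (rule J_2_le)
    fix A \<alpha> \<beta> \<gamma> x y
    assume *: "A \<in> V" "\<alpha> \<in> Con F A" "\<beta> \<in> Con F A" "\<gamma> \<in> Con F A" "(x, y) \<in> \<alpha> \<inter> (\<beta> O \<gamma> O \<beta>)"
    obtain e where e: "(x, e) \<in> alt_comp (J_smile F V 1 + 1) (\<alpha> \<inter> \<beta>) (\<alpha> \<inter> \<gamma>)"
      "(e, y) \<in> alt_comp (2 * k) (\<alpha> \<inter> \<gamma>) (\<alpha> \<inter> \<beta>)" using split[OF *] by blast
    show "(x, y) \<in> alt_comp (J_smile F V 1 + 2 * k + 1) (\<alpha> \<inter> \<beta>) (\<alpha> \<inter> \<gamma>)"
    proof (cases "k = 0")
      case True
      then show ?thesis using e by simp
    next
      case False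
      then show ?thesis
        using that alt_comp_join_chains(1)[OF tr[OF *(2,3)] tr[OF *(2,4)] e] by simp
    qed
  qed
  show "J F V 2 \<le> J_smile F V 1 + 2 * k - 1" if "odd (J_smile F V 1)" "k \<ge> 1"
  proof (rule J_2_le)
    fix A \<alpha> \<beta> \<gamma> x y
    assume *: "A \<in> V" "\<alpha> \<in> Con F A" "\<beta> \<in> Con F A" "\<gamma> \<in> Con F A" "(x, y) \<in> \<alpha> \<inter> (\<beta> O \<gamma> O \<beta>)"
    obtain e where e: "(x, e) \<in> alt_comp (J_smile F V 1 + 1) (\<alpha> \<inter> \<beta>) (\<alpha> \<inter> \<gamma>)"
      "(e, y) \<in> alt_comp (2 * k) (\<alpha> \<inter> \<gamma>) (\<alpha> \<inter> \<beta>)" using split[OF *] by blast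
    show "(x, y) \<in> alt_comp (J_smile F V 1 + 2 * k - 1 + 1) (\<alpha> \<inter> \<beta>) (\<alpha> \<inter> \<gamma>)"
      using that alt_comp_join_chains(2)[OF tr[OF *(2,3)] tr[OF *(2,4)] e] by simp
  qed
  show "J_smile F V 2 \<le> J F V 1 + 2 * k" if "odd (J F V 1) \<or> k = 0"
  proof (rule J_smile_2_le)
    fix A \<alpha> \<beta> \<gamma> x y
    assume *: "A \<in> V" "\<alpha> \<in> Con F A" "\<beta> \<in> Con F A" "\<gamma> \<in> Con F A" "(x, y) \<in> \<alpha> \<inter> (\<beta> O \<gamma> O \<beta>)"
    obtain e where e: "(x, e) \<in> alt_comp (J F V 1 + 1) (\<alpha> \<inter> \<gamma>) (\<alpha> \<inter> \<beta>)"
      "(e, y) \<in> alt_comp (2 * k) (\<alpha> \<inter> \<gamma>) (\<alpha> \<inter> \<beta>)" using split[OF *] by blast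
    show "(x, y) \<in> alt_comp (J F V 1 + 2 * k + 1) (\<alpha> \<inter> \<gamma>) (\<alpha> \<inter> \<beta>)"
    proof (cases "k = 0")
      case True
      then show ?thesis using e by simp
    next
      case False
      then show ?thesis
        using that alt_comp_join_chains(1)[OF tr[OF *(2,4)] tr[OF *(2,3)] e] by simp
    qed
  qed
  show "J_smile F V 2 \<le> J F V 1 + 2 * k - 1" if "even (J F V 1)" "k \<ge> 1"
  proof (rule J_smile_2_le)
    fix A \<alpha> \<beta> \<gamma> x y
    assume *: "A \<in> V" "\<alpha> \<in> Con F A" "\<beta> \<in> Con F A" "\<gamma> \<in> Con F A" "(x, y) \<in> \<alpha> \<inter> (\<beta> O \<gamma> O \<beta>)"
    obtain e where e: "(x, e) \<in> alt_comp (J F V 1 + 1) (\<alpha> \<inter> \<gamma>) (\<alpha> \<inter> \<beta>)"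
      "(e, y) \<in> alt_comp (2 * k) (\<alpha> \<inter> \<gamma>) (\<alpha> \<inter> \<beta>)" using split[OF *] by blast
    show "(x, y) \<in> alt_comp (J F V 1 + 2 * k - 1 + 1) (\<alpha> \<inter> \<gamma>) (\<alpha> \<inter> \<beta>)"
      using that alt_comp_join_chains(2)[OF tr[OF *(2,4)] tr[OF *(2,3)] e] by simp
  qed
qed

section \<open>From modularity to Gumm terms\<close>

definition val4 :: "'u \<Rightarrow> 'u \<Rightarrow> 'u \<Rightarrow> 'u \<Rightarrow> nat \<Rightarrow> 'u" where
  "val4 x y z w i = (if i = 0 then x else if i = 1 then y else if i = 2 then z else w)"

definition quaternary_op :: "('f, 'u) algebra \<Rightarrow> 'f trm \<Rightarrow> 'u \<Rightarrow> 'u \<Rightarrow> 'u \<Rightarrow> 'u \<Rightarrow> 'u" where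
  "quaternary_op A t x y z w = trm_val A (val4 x y z w) t"

lemma quaternary_op_Con:
  assumes "\<theta> \<in> Con F A" "wf_trm F t"
    and "(x, x') \<in> \<theta>" "(y, y') \<in> \<theta>" "(z, z') \<in> \<theta>" "(w, w') \<in> \<theta>"
  shows "(quaternary_op A t x y z w, quaternary_op A t x' y' z' w') \<in> \<theta>"
  unfolding quaternary_op_def using assms by (intro trm_val_Con) (auto simp: val4_def)

definition Day_terms ::
  "('f \<times> nat) set \<Rightarrow> ('f, 'u) algebra set \<Rightarrow> nat \<Rightarrow> (nat \<Rightarrow> 'f trm) \<Rightarrow> bool" where
  "Day_terms F V m d \<longleftrightarrow>
     (\<forall>i\<le>m. wf_trm F (d i)) \<and>
     (\<forall>A\<in>V. \<forall>x\<in>univ A. \<forall>y\<in>univ A. \<forall>z\<in>univ A. \<forall>w\<in>univ A.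
        quaternary_op A (d 0) x y z w = x \<and>
        quaternary_op A (d m) x y z w = w \<and>
        (\<forall>i\<le>m. quaternary_op A (d i) x y y x = x) \<and>
        (\<forall>i<m. even i \<longrightarrow> quaternary_op A (d i) x x w w = quaternary_op A (d (Suc i)) x x w w) \<and>
        (\<forall>i<m. odd i \<longrightarrow> quaternary_op A (d i) x y y w = quaternary_op A (d (Suc i)) x y y w))"

text \<open>In the algebra that is free over the generators 0, 1, 2, 3, the inclusion is applied to the
  pair (0, 3) and the kernels that identify 0 with 3 and 1 with 2, respectively 0 with 1 and 2 with 3,
  respectively 1 with 2.\<close>

lemma modular_imp_Day_terms:
  fixes F :: "('f \<times> nat) set" and V :: "('f, 'u) algebra set"
  assumes inf: "infinite (UNIV :: 'u set)" and F: "F \<lesssim> (UNIV :: 'u set)"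
    and V: "variety F V" and mod: "modular F V m"
  shows "\<exists>d. Day_terms F V m d"
proof -
  obtain q :: "'f trm \<Rightarrow> 'u" where "free_algebra F V {0, 1, 2, 3} q"
    using ex_free_algebra[OF inf F V, of "{0, 1, 2, 3}"] by auto
  then interpret free_algebra F V "{0, 1, 2, 3}" q .
  let ?P = "\<lambda>v :: nat \<Rightarrow> 'u. v 0 = v 3 \<and> v 1 = v 2" and ?Q = "\<lambda>v :: nat \<Rightarrow> 'u. v 0 = v 1 \<and> v 2 = v 3"
    and ?R = "\<lambda>v :: nat \<Rightarrow> 'u. v 1 = v 2"
  have "(q (Var 0), q (Var 3)) \<in> Ker ?P" "(q (Var 0), q (Var 1)) \<in> Ker ?Q"
    "(q (Var 1), q (Var 2)) \<in> Ker ?P" "(q (Var 1), q (Var 2)) \<in> Ker ?R"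
    "(q (Var 2), q (Var 3)) \<in> Ker ?Q"
    by (rule Var_Ker; simp)+
  then have "(q (Var 0), q (Var 3)) \<in> Ker ?P \<inter> (Ker ?Q O (Ker ?P \<inter> Ker ?R) O Ker ?Q)"
    by (intro IntI relcompI)
  then have "(q (Var 0), q (Var 3)) \<in> alt_comp m (Ker ?P \<inter> Ker ?Q) (Ker ?P \<inter> Ker ?R)"
    by (rule inclusion_holdsD[OF mod[unfolded modular_def] Fr_in_V Ker_Con Ker_Con Ker_Con])
  then obtain e where e0: "e 0 = q (Var 0)" and em: "e m = q (Var 3)"
    and "\<forall>i<m.
      (e i, e (Suc i)) \<in> (if even i then Ker ?P \<inter> Ker ?Q else Ker ?P \<inter> Ker ?R)"
    by (rule alt_comp_chain) blast
  then have stepP: "(e i, e (Suc i)) \<in> Ker ?P"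
    and stepQ: "even i \<Longrightarrow> (e i, e (Suc i)) \<in> Ker ?Q"
    and stepR: "odd i \<Longrightarrow> (e i, e (Suc i)) \<in> Ker ?R" if "i < m" for i
    using that by (auto split: if_splits)
  have eP: "(q (Var 0), e i) \<in> Ker ?P" if "i \<le> m" for i
    using that
  proof (induction i)
    case 0
    show ?case unfolding e0 by (rule Var_Ker) simp_all
  next
    case (Suc i)
    then have "(q (Var 0), e i) \<in> Ker ?P" "(e i, e (Suc i)) \<in> Ker ?P" using stepP by auto
    then show ?case by (rule Con_trans[OF Ker_Con])
  qed
  have wf: "wf_trm F (rep (e i))" if "i \<le> m" for i
    using rep Con_carrier[OF Ker_Con eP[OF that]] unfolding terms_def by simp
  have Var_val: "trm_val A v (rep (q (Var i))) = v i"
    if "A \<in> V" "range v \<subseteq> univ A" "i \<in> {0, 1, 2, 3}" for A v i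
    using rep_q[OF Var_terms[OF that(3)] that(1,2)] by simp
  have "Day_terms F V m (\<lambda>i. rep (e i))"
    unfolding Day_terms_def
  proof (intro conjI ballI allI impI)
    fix A x y z w assume A: "A \<in> V"
      and U: "x \<in> univ A" "y \<in> univ A" "z \<in> univ A" "w \<in> univ A"
    have range: "range (val4 x1 x2 x3 x4) \<subseteq> univ A"
      if "{x1, x2, x3, x4} \<subseteq> univ A" for x1 x2 x3 x4
      using that unfolding val4_def by auto
    show "quaternary_op A (rep (e 0)) x y z w = x" "quaternary_op A (rep (e m)) x y z w = w"
      unfolding quaternary_op_def e0 em using Var_val[OF A range] U by (simp_all add: val4_def)
    show "quaternary_op A (rep (e i)) x y y x = x" if "i \<le> m" for i
      unfolding quaternary_op_def
      using Ker_val[OF eP[OF that] A range, of x y y x] Var_val[OF A range, of x y y x 0] U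
      by (simp add: val4_def)
    show "quaternary_op A (rep (e i)) x x w w = quaternary_op A (rep (e (Suc i))) x x w w"
      if "i < m" "even i" for i
      unfolding quaternary_op_def
      using Ker_val[OF stepQ[OF that] A range, of x x w w] U by (simp add: val4_def)
    show "quaternary_op A (rep (e i)) x y y w = quaternary_op A (rep (e (Suc i))) x y y w"
      if "i < m" "odd i" for i
      unfolding quaternary_op_def
      using Ker_val[OF stepR[OF that] A range, of x y y w] U by (simp add: val4_def)
  qed (rule wf)
  then show ?thesis by blast
qed

text \<open>An equality between values of \<open>f\<close> with \<open>s\<close> in the third place is transported, modulo the
  join of \<open>\<alpha> \<inter> \<phi>\<close> and \<open>\<alpha> \<inter> \<psi>\<close>, to \<open>t\<close> in the third place, where \<open>t \<phi> b \<psi> s\<close>: with \<open>b\<close> in the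
  third place the two values are congruent modulo \<open>\<alpha> \<inter> \<psi>\<close>, and the step from \<open>b\<close> to \<open>t\<close> is
  exactly what \<open>m\<close>-modularity handles.\<close>

lemma modular_shift:
  assumes mod: "modular F V m" and A: "A \<in> V"
    and \<alpha>: "\<alpha> \<in> Con F A" and \<phi>: "\<phi> \<in> Con F A" and \<psi>: "\<psi> \<in> Con F A"
    and wf: "wf_trm F f" and ua: "(u, a) \<in> \<alpha>" and sa: "(s, a) \<in> \<alpha>" and ac: "(a, c) \<in> \<alpha>"
    and tb: "(t, b) \<in> \<phi>" and bs: "(b, s) \<in> \<psi>"
    and eq: "quaternary_op A f u s s u = quaternary_op A f a a s c"
  shows "(quaternary_op A f u s t u, quaternary_op A f a a t c) \<in> alt_comp m (\<alpha> \<inter> \<phi>) (\<alpha> \<inter> \<psi>)"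
    and "(quaternary_op A f a a t c, quaternary_op A f u s t u) \<in> alt_comp m (\<alpha> \<inter> \<phi>) (\<alpha> \<inter> \<psi>)"
proof -
  let ?f = "quaternary_op A f"
  have U: "u \<in> univ A" "s \<in> univ A" "t \<in> univ A" "a \<in> univ A" "b \<in> univ A" "c \<in> univ A"
    using Con_carrier[OF \<alpha> ua] Con_carrier[OF \<alpha> sa] Con_carrier[OF \<alpha> ac] Con_carrier[OF \<phi> tb]
    by simp_all
  have third: "(?f x y z w, ?f x y z' w) \<in> \<theta>"
    if "\<theta> \<in> Con F A" "(z, z') \<in> \<theta>" "{x, y, w} \<subseteq> univ A" for \<theta> x y z z' w
    using that Con_refl[OF that(1)] by (intro quaternary_op_Con[OF that(1) wf]) auto
  have others: "(?f u s z u, ?f a a z c) \<in> \<alpha>" if "z \<in> univ A" for z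
    by (rule quaternary_op_Con[OF \<alpha> wf ua sa Con_refl[OF \<alpha> that] Con_trans[OF \<alpha> ua ac]])
  have 1: "(?f u s t u, ?f u s b u) \<in> \<phi>" by (rule third[OF \<phi> tb]) (use U in simp)
  have "(?f u s b u, ?f u s s u) \<in> \<psi>" by (rule third[OF \<psi> bs]) (use U in simp)
  moreover have "(?f a a s c, ?f a a b c) \<in> \<psi>"
    by (rule third[OF \<psi> Con_sym[OF \<psi> bs]]) (use U in simp)
  ultimately have "(?f u s b u, ?f a a b c) \<in> \<psi>" unfolding eq by (rule Con_trans[OF \<psi>])
  with others[OF U(5)] have 2: "(?f u s b u, ?f a a b c) \<in> \<alpha> \<inter> \<psi>" by (rule IntI)
  have 3: "(?f a a b c, ?f a a t c) \<in> \<phi>"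
    by (rule third[OF \<phi> Con_sym[OF \<phi> tb]]) (use U in simp)
  have incl: "p \<in> alt_comp m (\<alpha> \<inter> \<phi>) (\<alpha> \<inter> \<psi>)" if "p \<in> \<alpha> \<inter> (\<phi> O (\<alpha> \<inter> \<psi>) O \<phi>)" for p
    using that by (rule inclusion_holdsD[OF mod[unfolded modular_def] A \<alpha> \<phi> \<psi>])
  show "(?f u s t u, ?f a a t c) \<in> alt_comp m (\<alpha> \<inter> \<phi>) (\<alpha> \<inter> \<psi>)"
    by (rule incl) (intro IntI others[OF U(3)] relcompI[OF 1 relcompI[OF 2 3]])
  show "(?f a a t c, ?f u s t u) \<in> alt_comp m (\<alpha> \<inter> \<phi>) (\<alpha> \<inter> \<psi>)"
    by (rule incl) (intro IntI Con_sym[OF \<alpha> others[OF U(3)]]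
      relcompI[OF Con_sym[OF \<phi> 3] relcompI[OF Con_sym[OF Con_Int[OF \<alpha> \<psi>] 2] Con_sym[OF \<phi> 1]]])
qed

text \<open>Let \<open>a \<beta> b \<gamma> c\<close> and \<open>a \<alpha> c\<close>. Starting from \<open>a\<close>, the polynomials \<open>Q i\<close> nest the Day terms, so
  that \<open>Q i c = a\<close> for all \<open>i\<close>; hence \<open>a \<gamma> Q i b \<beta> Q i a\<close>. It remains to reach \<open>c\<close> from
  \<open>Q (m - 1) a\<close> by alternating steps. The element \<open>v i\<close> is a common value of \<open>d i\<close> and \<open>d (i + 1)\<close>,
  with \<open>v 0 = a\<close> and \<open>v (m - 1) = c\<close>. By induction \<open>Q i a\<close> and \<open>v i\<close> are connected by \<open>i * m\<close> steps:
  once \<open>Q i a\<close> is replaced by \<open>v i\<close>, the elements \<open>Q (i + 1) a\<close> and \<open>v (i + 1)\<close> are two values of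
  \<open>d (i + 1)\<close> with the same third argument \<open>a\<close> or \<open>c\<close>, and exchanging this for the other one of \<open>a\<close>, \<open>c\<close>
  turns both into \<open>v i\<close>, so that \<open>modular_shift\<close> applies. The first of the \<open>m * (m - 1)\<close> steps is
  one modulo \<open>\<alpha> \<inter> \<beta>\<close> and is absorbed by the preceding \<open>\<beta>\<close>.\<close>

lemma Day_terms_imp_Gumm_inclusion:
  assumes day: "Day_terms F V m d" and mod: "modular F V m" and k: "Suc k = (m - 1) * m"
    and A: "A \<in> V"
    and \<alpha>: "\<alpha> \<in> Con F A" and \<beta>: "\<beta> \<in> Con F A" and \<gamma>: "\<gamma> \<in> Con F A"
    and "(a, c) \<in> \<alpha> \<inter> (\<beta> O \<gamma>)"
  shows "\<exists>e. (a, e) \<in> \<alpha> \<inter> (\<gamma> O \<beta>) \<and> (e, c) \<in> alt_comp k (\<alpha> \<inter> \<gamma>) (\<alpha> \<inter> \<beta>)"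
proof -
  let ?B = "\<alpha> \<inter> \<beta>" and ?C = "\<alpha> \<inter> \<gamma>"
  have B: "?B \<in> Con F A" and C: "?C \<in> Con F A" using Con_Int \<alpha> \<beta> \<gamma> by auto
  from assms(8) obtain b where ac: "(a, c) \<in> \<alpha>" and ab: "(a, b) \<in> \<beta>" and bc: "(b, c) \<in> \<gamma>"
    by auto
  have U: "a \<in> univ A" "b \<in> univ A" "c \<in> univ A"
    using Con_carrier[OF \<alpha> ac] Con_carrier[OF \<beta> ab] by auto
  have aa: "(a, a) \<in> \<alpha>" and ca: "(c, a) \<in> \<alpha>" using Con_refl[OF \<alpha> U(1)] Con_sym[OF \<alpha> ac] by auto
  define D where "D i = quaternary_op A (d i)" for i
  have wf: "wf_trm F (d i)" if "i \<le> m" for i using day that unfolding Day_terms_def by blast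
  have D_first: "D 0 x y z w = x" and D_last: "D m x y z w = w"
    and D_absorb: "\<And>i. i \<le> m \<Longrightarrow> D i x y y x = x"
    and D_even: "\<And>i. i < m \<Longrightarrow> even i \<Longrightarrow> D i x x w w = D (Suc i) x x w w"
    and D_odd: "\<And>i. i < m \<Longrightarrow> odd i \<Longrightarrow> D i x y y w = D (Suc i) x y y w"
    if "x \<in> univ A" "y \<in> univ A" "z \<in> univ A" "w \<in> univ A" for x y z w
    using day A that unfolding Day_terms_def D_def by simp_all
  have D_Con: "(D i x y z w, D i x' y' z' w') \<in> \<theta>"
    if "i \<le> m" "\<theta> \<in> Con F A" "(x, x') \<in> \<theta>" "(y, y') \<in> \<theta>" "(z, z') \<in> \<theta>" "(w, w') \<in> \<theta>"
    for i \<theta> x y z w x' y' z' w'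
    unfolding D_def using that(3-6) by (rule quaternary_op_Con[OF that(2) wf[OF that(1)]])
  define Q where "Q i y = rec_nat a
    (\<lambda>i r. if even i then D (Suc i) r c y r else D (Suc i) r y c r) i" for i y
  have Q_simps: "Q 0 y = a"
    "Q (Suc i) y = (if even i then D (Suc i) (Q i y) c y (Q i y) else D (Suc i) (Q i y) y c (Q i y))"
    for i y unfolding Q_def by simp_all
  have Q_Con: "(Q i y, Q i y') \<in> \<theta>" if \<theta>: "\<theta> \<in> Con F A" and y: "(y, y') \<in> \<theta>" and "i \<le> m" for \<theta> y y' i
    using that(3)
  proof (induction i)
    case (Suc i)
    then have "(Q i y, Q i y') \<in> \<theta>" by simp
    then show ?case
      unfolding Q_simps
      using D_Con[OF Suc.prems \<theta>] Con_refl[OF \<theta> U(3)] y by simp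
  qed (simp add: Q_simps Con_refl[OF \<theta> U(1)])
  have Q_c: "Q i c = a" if "i \<le> m" for i
    using that by (induction i) (simp_all add: Q_simps D_absorb[OF U(1,3,3,3)])
  define v where "v i = D i a a (if even i then c else a) c" for i
  have v_\<alpha>: "(v i, a) \<in> \<alpha>" if "i \<le> m" for i
    using D_Con[OF that \<alpha> aa aa _ ca, of _ a] D_absorb[OF U(1,1,1,1) that] aa ca
    unfolding v_def by simp
  have Q_v: "(Q i a, v i) \<in> alt_comp (i * m) ?B ?C" if "i \<le> m" for i
    using that
  proof (induction i)
    case 0
    show ?case unfolding v_def Q_simps using D_first[OF U(1,1,3,3)] by simp
  next
    case (Suc i)
    then have i: "i < m" and IH: "(Q i a, v i) \<in> alt_comp (i * m) ?B ?C" by auto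
    let ?s = "if even i then c else a" and ?t = "if even i then a else c"
    let ?f = "D (Suc i)"
    have st: "?s \<in> univ A" "?t \<in> univ A" using U by auto
    have Q_Suc: "Q (Suc i) a = ?f (Q i a) ?s ?t (Q i a)" unfolding Q_simps by simp
    have "(?f (Q i a) ?s ?t (Q i a), ?f (v i) ?s ?t (v i)) \<in> alt_comp (i * m) ?B ?C"
    proof (rule alt_comp_map[OF _ _ IH])
      show "(?f x ?s ?t x, ?f y ?s ?t y) \<in> ?B" if "(x, y) \<in> ?B" for x y
        by (rule D_Con[OF Suc.prems B that Con_refl[OF B st(1)] Con_refl[OF B st(2)] that])
      show "(?f x ?s ?t x, ?f y ?s ?t y) \<in> ?C" if "(x, y) \<in> ?C" for x y
        by (rule D_Con[OF Suc.prems C that Con_refl[OF C st(1)] Con_refl[OF C st(2)] that])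
    qed
    moreover have "(?f (v i) ?s ?t (v i), v (Suc i)) \<in>
        (if even (i * m) then alt_comp m ?B ?C else alt_comp m ?C ?B)"
    proof -
      have v: "(v i, a) \<in> \<alpha>" "v i \<in> univ A" using v_\<alpha>[of i] i Con_carrier[OF \<alpha>] by auto
      have "?f (v i) ?s ?s (v i) = v i" by (rule D_absorb[OF v(2) st(1) v(2) v(2) Suc.prems])
      also have "v i = ?f a a ?s c"
        unfolding v_def using D_even[OF U(1,1,1,3) i] D_odd[OF U(1,1,1,3) i] by simp
      finally have eq: "?f (v i) ?s ?s (v i) = ?f a a ?s c" .
      have v_Suc: "v (Suc i) = ?f a a ?t c" unfolding v_def by simp
      note shift = modular_shift[OF mod A \<alpha> _ _ wf[OF Suc.prems] v(1) _ ac, folded D_def]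
      show ?thesis
      proof (cases "even i")
        case True
        then show ?thesis
          unfolding v_Suc using shift(1)[OF \<beta> \<gamma> ca ab bc] eq by simp
      next
        case False
        then have C_B: "(?f (v i) a c (v i), ?f a a c c) \<in> alt_comp m ?C ?B"
          "(?f a a c c, ?f (v i) a c (v i)) \<in> alt_comp m ?C ?B"
          using shift[OF \<gamma> \<beta> aa Con_sym[OF \<gamma> bc] Con_sym[OF \<beta> ab]] eq by simp_all
        \<comment> \<open>For odd \<open>m\<close> the previous stage ended with \<open>\<alpha> \<inter> \<beta>\<close> and this one starts with \<open>\<alpha> \<inter> \<gamma>\<close>;
          for even \<open>m\<close> it is read backwards to start with \<open>\<alpha> \<inter> \<beta>\<close>.\<close>
        have "(?f (v i) a c (v i), ?f a a c c) \<in> alt_comp m ?B ?C" if "even m"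
          using C_B(2) converse_alt_comp[OF Con_is_sym[OF C] Con_is_sym[OF B], of m] that by auto
        then show ?thesis unfolding v_Suc using C_B(1) False by simp
      qed
    qed
    ultimately have "(Q (Suc i) a, v (Suc i)) \<in> alt_comp (i * m + m) ?B ?C"
      unfolding Q_Suc alt_comp_add by (rule relcompI)
    then show ?case by (simp add: add.commute)
  qed
  have m: "m - 1 < m" "Suc (m - 1) = m" using k by (cases m; simp)+
  have "v (m - 1) = c"
    unfolding v_def
    using D_even[OF U(1,1,1,3) m(1)] D_odd[OF U(1,1,1,3) m(1)]
      D_last[OF U(1,1,1,3)] D_last[OF U(1,1,3,3)] m(2)
    by simp
  then have "(Q (m - 1) a, c) \<in> alt_comp (Suc k) ?B ?C" using Q_v[of "m - 1"] k by simp
  then obtain e where e: "(Q (m - 1) a, e) \<in> ?B" "(e, c) \<in> alt_comp k ?C ?B" by auto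
  have le: "m - 1 \<le> m" by simp
  have "(a, Q (m - 1) b) \<in> \<gamma>"
    using Q_Con[OF \<gamma> Con_sym[OF \<gamma> bc] le] unfolding Q_c[OF le] .
  moreover have "(Q (m - 1) b, e) \<in> \<beta>"
    using Con_trans[OF \<beta> Q_Con[OF \<beta> Con_sym[OF \<beta> ab] le] IntD2[OF e(1)]] .
  moreover have "(a, Q (m - 1) a) \<in> \<alpha>" using Q_Con[OF \<alpha> ca le] unfolding Q_c[OF le] .
  then have "(a, e) \<in> \<alpha>" using IntD1[OF e(1)] by (rule Con_trans[OF \<alpha>])
  ultimately show ?thesis using e(2) by blast
qed

text \<open>The element \<open>r\<close> with \<open>a \<gamma> r \<beta> e\<close> and those of the chain from \<open>e\<close> to \<open>c\<close>, obtained for the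
  pair (0, 2) of generators and the kernels that identify 0 with 2, 0 with 1 and 1 with 2, are
  represented by terms; these are \<open>p\<close> and \<open>j\<^sub>1, \<dots>, j\<^bsub>k+1\<^esub>\<close>.\<close>

lemma Gumm_inclusion_imp_terms:
  fixes F :: "('f \<times> nat) set" and V :: "('f, 'u) algebra set"
  assumes inf: "infinite (UNIV :: 'u set)" and F: "F \<lesssim> (UNIV :: 'u set)" and V: "variety F V"
    and incl: "\<And>A \<alpha> \<beta> \<gamma> a c. A \<in> V \<Longrightarrow> \<alpha> \<in> Con F A \<Longrightarrow> \<beta> \<in> Con F A \<Longrightarrow> \<gamma> \<in> Con F A \<Longrightarrow>
      (a, c) \<in> \<alpha> \<inter> (\<beta> O \<gamma>) \<Longrightarrow>
      \<exists>e. (a, e) \<in> \<alpha> \<inter> (\<gamma> O \<beta>) \<and> (e, c) \<in> alt_comp k (\<alpha> \<inter> \<gamma>) (\<alpha> \<inter> \<beta>)"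
  shows "has_gumm_terms F V k"
proof -
  obtain q :: "'f trm \<Rightarrow> 'u" where "free_algebra F V {0, 1, 2} q"
    using ex_free_algebra[OF inf F V, of "{0, 1, 2}"] by auto
  then interpret free_algebra F V "{0, 1, 2}" q .
  let ?P = "\<lambda>v :: nat \<Rightarrow> 'u. v 0 = v 2" and ?Q = "\<lambda>v :: nat \<Rightarrow> 'u. v 0 = v 1"
    and ?R = "\<lambda>v :: nat \<Rightarrow> 'u. v 1 = v 2"
  let ?x = "q (Var 0)" and ?z = "q (Var 2)"
  have "(?x, ?z) \<in> Ker ?P" "(?x, q (Var 1)) \<in> Ker ?Q" "(q (Var 1), ?z) \<in> Ker ?R"
    by (rule Var_Ker; simp)+
  then have "(?x, ?z) \<in> Ker ?P \<inter> (Ker ?Q O Ker ?R)" by (intro IntI relcompI)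
  from incl[OF Fr_in_V Ker_Con Ker_Con Ker_Con this]
  obtain e r where xe: "(?x, e) \<in> Ker ?P" and xr: "(?x, r) \<in> Ker ?R" and re: "(r, e) \<in> Ker ?Q"
    and ez: "(e, ?z) \<in> alt_comp k (Ker ?P \<inter> Ker ?R) (Ker ?P \<inter> Ker ?Q)"
    by (elim exE conjE IntE relcompEpair)
  from ez obtain g where g0: "g 0 = e" and gk: "g k = ?z"
    and "\<forall>i<k.
      (g i, g (Suc i)) \<in> (if even i then Ker ?P \<inter> Ker ?R else Ker ?P \<inter> Ker ?Q)"
    by (rule alt_comp_chain) blast
  then have stepP: "(g i, g (Suc i)) \<in> Ker ?P"
    and stepQ: "odd i \<Longrightarrow> (g i, g (Suc i)) \<in> Ker ?Q"
    and stepR: "even i \<Longrightarrow> (g i, g (Suc i)) \<in> Ker ?R" if "i < k" for i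
    using that by (auto split: if_splits)
  have gP: "(?x, g i) \<in> Ker ?P" if "i \<le> k" for i
    using that
  proof (induction i)
    case (Suc i)
    then have "(?x, g i) \<in> Ker ?P" "(g i, g (Suc i)) \<in> Ker ?P" using stepP by auto
    then show ?case by (rule Con_trans[OF Ker_Con])
  qed (unfold g0, rule xe)
  have ternary: "ternary_trm F (rep y)" if "y \<in> univ Fr" for y
    using rep[OF that] unfolding terms_def ternary_trm_def by simp
  have Var_val: "trm_val A v (rep (q (Var i))) = v i"
    if "A \<in> V" "range v \<subseteq> univ A" "i \<in> {0, 1, 2}" for A v i
    using rep_q[OF Var_terms[OF that(3)] that(1,2)] by simp
  let ?j = "\<lambda>i. rep (g (i - 1))"
  show ?thesis
    unfolding has_gumm_terms_def
  proof (intro exI[of _ "rep r"] exI[of _ ?j] conjI ballI impI)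
    show "ternary_trm F (rep r)" using ternary Con_carrier[OF Ker_Con xr] by blast
    show "ternary_trm F (?j i)" if "i \<in> {1..k+1}" for i
      using ternary Con_carrier[OF Ker_Con gP[of "i - 1"]] that by auto
    fix A x y z assume A: "A \<in> V" and U: "x \<in> univ A" "y \<in> univ A" "z \<in> univ A"
    note range = range_val3[where U = "univ A"]
    show "x = ternary_op A (rep r) x z z"
      unfolding ternary_op_val3
      using Ker_val[OF xr A range[OF U(1,3,3)]] Var_val[OF A range[OF U(1,3,3)], of 0]
      by (simp add: val3_def)
    show "ternary_op A (rep r) x x z = ternary_op A (?j 1) x x z"
      unfolding ternary_op_val3 using Ker_val[OF re A range[OF U(1,1,3)]]
      by (simp add: val3_def g0)
    show "ternary_op A (?j (k + 1)) x y z = z"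
      unfolding ternary_op_val3 using Var_val[OF A range[OF U], of 2] by (simp add: val3_def gk)
    fix i
    show "x = ternary_op A (?j i) x y x" if "i \<in> {1..k+1}"
    proof -
      have "i - 1 \<le> k" using that by auto
      then show ?thesis
        unfolding ternary_op_val3
        using Ker_val[OF gP A range[OF U(1,2,1)]] Var_val[OF A range[OF U(1,2,1)], of 0]
        by (simp add: val3_def)
    qed
    show "ternary_op A (?j i) x x z = ternary_op A (?j (i + 1)) x x z" if "i \<in> {1..<k+1}" "even i"
    proof -
      from that obtain l where l: "i = Suc l" "l < k" "odd l" by (cases i) auto
      show ?thesis
        unfolding ternary_op_val3 using Ker_val[OF stepQ[OF l(2,3)] A range[OF U(1,1,3)]]
        by (simp add: val3_def l(1))
    qed
    show "ternary_op A (?j i) x z z = ternary_op A (?j (i + 1)) x z z" if "i \<in> {1..<k+1}" "odd i"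
    proof -
      from that obtain l where l: "i = Suc l" "l < k" "even l" by (cases i) auto
      show ?thesis
        unfolding ternary_op_val3 using Ker_val[OF stepR[OF l(2,3)] A range[OF U(1,3,3)]]
        by (simp add: val3_def l(1))
    qed
  qed
qed

theorem modular_imp_Gumm_terms:
  fixes F :: "('f \<times> nat) set" and V :: "('f, 'u) algebra set"
  assumes "infinite (UNIV :: 'u set)" "F \<lesssim> (UNIV :: 'u set)" "variety F V"
    and mod: "modular F V m" and k: "Suc k = (m - 1) * m"
  shows "has_gumm_terms F V k"
proof -
  obtain d where "Day_terms F V m d" using modular_imp_Day_terms[OF assms(1-3) mod] by blast
  then show ?thesis
    by (intro Gumm_inclusion_imp_terms[OF assms(1-3)] Day_terms_imp_Gumm_inclusion[OF _ mod k])
qed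

section \<open>The bounds\<close>

theorem theorem4p2:
  fixes F :: "('f \<times> nat) set" and V :: "('f, 'u) algebra set"
  assumes "infinite (UNIV :: 'u set)" and "F \<lesssim> (UNIV :: 'u set)"
    and "variety F V" and "congruence_distributive F V"
  shows "(\<forall>m\<ge>2. modular F V m \<longrightarrow>
            J F V 2 \<le> J_smile F V 1 + 2 * m\<^sup>2 - 2 * m - 2 \<and>
            J_smile F V 2 \<le> J F V 1 + 2 * m\<^sup>2 - 2 * m - 2) \<and>
         (\<forall>k. has_gumm_terms F V k \<longrightarrow>
            J F V 2 \<le> J_smile F V 1 + 2 * k \<and>
            J_smile F V 2 \<le> J F V 1 + 2 * k \<and>
            (k \<ge> 1 \<and> odd (J_smile F V 1) \<longrightarrow> J F V 2 \<le> J_smile F V 1 + 2 * k - 1) \<and>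
            (k \<ge> 1 \<and> even (J F V 1) \<longrightarrow> J_smile F V 2 \<le> J F V 1 + 2 * k - 1))"
proof -
  have gumm: "J F V 2 \<le> J_smile F V 1 + 2 * k \<and> J_smile F V 2 \<le> J F V 1 + 2 * k \<and>
      (k \<ge> 1 \<and> odd (J_smile F V 1) \<longrightarrow> J F V 2 \<le> J_smile F V 1 + 2 * k - 1) \<and>
      (k \<ge> 1 \<and> even (J F V 1) \<longrightarrow> J_smile F V 2 \<le> J F V 1 + 2 * k - 1)"
    if "has_gumm_terms F V k" for k
    using Gumm_bounds[OF assms that] by (cases "k = 0") force+
  have "J F V 2 \<le> J_smile F V 1 + 2 * m\<^sup>2 - 2 * m - 2 \<and>
      J_smile F V 2 \<le> J F V 1 + 2 * m\<^sup>2 - 2 * m - 2"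
    if m: "m \<ge> 2" and mod: "modular F V m" for m
  proof -
    have "(m - 1) * m \<ge> 1 * 1" using m by (intro mult_le_mono) auto
    then obtain k where k: "Suc k = (m - 1) * m" by (cases "(m - 1) * m") auto
    have "m\<^sup>2 = (m - 1) * m + m" using m by (simp add: power2_eq_square diff_mult_distrib)
    then have "J_smile F V 1 + 2 * m\<^sup>2 - 2 * m - 2 = J_smile F V 1 + 2 * k"
      "J F V 1 + 2 * m\<^sup>2 - 2 * m - 2 = J F V 1 + 2 * k" using k by simp_all
    then show ?thesis using gumm[OF modular_imp_Gumm_terms[OF assms(1-3) mod k]] by simp
  qed
  then show ?thesis using gumm by blast
qed

end
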